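(* Let $G$ be a finite simple outerplanar graph of maximum degree $\Delta \geq 5$. Then $\mathrm{ind}(G^2) \leq \Delta + 1$. If moreover $\Delta \geq 7$, then $\mathrm{ind}(G^2) = \Delta$.
   Context: For a graph $G$, the square $G^2$ is the graph on $V(G)$ in which two distinct vertices are adjacent iff their distance in $G$ is 1 or 2. The inductiveness (degeneracy) of a graph $H$ is $\mathrm{ind}(H) = \max\{\delta(H') : H' \text{ an induced subgraph of } H\}$, where $\delta$ denotes minimum degree. *)

theory Defs
  imports "HOL-Analysis.Analysis" "HOL-Library.Extended_Nat"
begin

text \<open>A graph is given by its vertex set \<open>V\<close> and its set \<open>E\<close> of two-element edges.\<close>

definition finite_simple_graph :: "'a set \<Rightarrow> 'a set set \<Rightarrow> bool" where
  "finite_simple_graph V E \<longleftrightarrow> finite V \<and> (\<forall>e\<in>E. e \<subseteq> V \<and> card e = 2)"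

definition vdegree :: "'a set set \<Rightarrow> 'a \<Rightarrow> nat" where
  "vdegree E v = card {e \<in> E. v \<in> e}"

text \<open>The inserted 0 only matters for the graph without vertices, whose maximum degree is
  thereby 0 instead of an unspecified number.\<close>

definition max_degree :: "'a set \<Rightarrow> 'a set set \<Rightarrow> nat" where
  "max_degree V E = Max (insert 0 (vdegree E ` V))"

definition min_degree :: "'a set \<Rightarrow> 'a set set \<Rightarrow> nat" where
  "min_degree V E = Min (vdegree E ` V)"

definition walk_betw :: "'a set \<Rightarrow> 'a set set \<Rightarrow> 'a \<Rightarrow> 'a list \<Rightarrow> 'a \<Rightarrow> bool" where
  "walk_betw V E u xs v \<longleftrightarrow> xs \<noteq> [] \<and> set xs \<subseteq> V \<and> hd xs = u \<and> last xs = v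
     \<and> successively (\<lambda>x y. {x, y} \<in> E) xs"

text \<open>The distance is \<open>\<infinity>\<close> between vertices of different components.\<close>

definition gdist :: "'a set \<Rightarrow> 'a set set \<Rightarrow> 'a \<Rightarrow> 'a \<Rightarrow> enat" where
  "gdist V E u v = (INF xs \<in> {xs. walk_betw V E u xs v}. enat (length xs - 1))"

definition square_edges :: "'a set \<Rightarrow> 'a set set \<Rightarrow> 'a set set" where
  "square_edges V E =
     {{u, v} | u v. u \<in> V \<and> v \<in> V \<and> u \<noteq> v \<and> (gdist V E u v = 1 \<or> gdist V E u v = 2)}"

definition induced_edges :: "'a set set \<Rightarrow> 'a set \<Rightarrow> 'a set set" where
  "induced_edges E S = {e \<in> E. e \<subseteq> S}"

definition inductiveness :: "'a set \<Rightarrow> 'a set set \<Rightarrow> nat" where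
  "inductiveness V E = Max {min_degree S (induced_edges E S) | S. S \<subseteq> V \<and> S \<noteq> {}}"

text \<open>A plane embedding places the vertices by \<open>p\<close> and draws each edge \<open>e\<close> as the Jordan
  arc \<open>c e\<close>.\<close>

definition plane_embedding ::
    "'a set \<Rightarrow> 'a set set \<Rightarrow> ('a \<Rightarrow> complex) \<Rightarrow> ('a set \<Rightarrow> real \<Rightarrow> complex) \<Rightarrow> bool" where
  "plane_embedding V E p c \<longleftrightarrow>
     inj_on p V
     \<and> (\<forall>e\<in>E. arc (c e) \<and> {pathstart (c e), pathfinish (c e)} = p ` e
              \<and> path_image (c e) \<inter> p ` V = p ` e)
     \<and> (\<forall>e\<in>E. \<forall>f\<in>E. e \<noteq> f \<longrightarrow> path_image (c e) \<inter> path_image (c f) \<subseteq> p ` (e \<inter> f))"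

definition drawing ::
    "'a set \<Rightarrow> 'a set set \<Rightarrow> ('a \<Rightarrow> complex) \<Rightarrow> ('a set \<Rightarrow> real \<Rightarrow> complex) \<Rightarrow> complex set" where
  "drawing V E p c = p ` V \<union> (\<Union>e\<in>E. path_image (c e))"

text \<open>The drawing of a finite graph is compact, so \<^const>\<open>outside\<close> of it is its unique
  unbounded face.\<close>

definition outerplanar :: "'a set \<Rightarrow> 'a set set \<Rightarrow> bool" where
  "outerplanar V E \<longleftrightarrow>
     (\<exists>p c. plane_embedding V E p c \<and> p ` V \<subseteq> frontier (outside (drawing V E p c)))"

end

theory Submission
  imports Defs "HOL-Library.Sublist" "HOL-Library.Transitive_Closure_Table"
begin

text \<open>In a drawing with all vertices on the outer face no vertex lies inside a cycle.  Together with
  the Jordan curve theorem this excludes three internally disjoint paths with inner vertices between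
  two vertices, and cycles with two crossing chords.  The latter forces a vertex of degree at most
  2; deleting it and joining its neighbours keeps the graph outerplanar, and by induction the
  vertices can be arranged on a circle so that no two edges cross.

  On a circle, an arc of positions that edges leave only through its two ends splits into two such
  arcs.  Enumerating the ways to combine small arcs shows that an arc spanning more than five steps
  always contains a vertex of degree at most 2 with at most \<open>k\<close> vertices at distance 1 or 2, where
  \<open>k = \<Delta>\<close> if \<open>\<Delta> \<ge> 7\<close> and \<open>k = \<Delta> + 1\<close> if \<open>\<Delta> \<in> {5, 6}\<close>.  If such a vertex lies in the set inducing
  the subgraph of the square, its degree there is at most \<open>k\<close>; otherwise deleting it and joining its
  neighbours does not increase degrees and destroys no adjacency of the square between other
  vertices.  The lower bound is witnessed by the closed neighbourhood of a vertex of maximum degree,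
  a clique of the square.\<close>

subsection \<open>Theta curves\<close>

definition arc_between :: "'a::topological_space \<Rightarrow> 'a \<Rightarrow> 'a set \<Rightarrow> bool" where
  "arc_between a b A \<longleftrightarrow> (\<exists>g. arc g \<and> pathstart g = a \<and> pathfinish g = b \<and> path_image g = A)"

lemma arc_betweenE:
  assumes "arc_between a b A"
  obtains g where "arc g" "pathstart g = a" "pathfinish g = b" "path_image g = A"
  using assms by (auto simp: arc_between_def)

lemma arc_between_commute: "arc_between a b A \<longleftrightarrow> arc_between b a A"
proof -
  have "arc_between d c C" if "arc_between c d C" for c d C
    using that unfolding arc_between_def
    by (metis arc_reversepath path_image_reversepath pathfinish_reversepath pathstart_reversepath)
  then show ?thesis by blast
qed

lemma arc_between_join:
  assumes "arc_between a b A" "arc_between b c B" "A \<inter> B = {b}"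
  shows "arc_between a c (A \<union> B)"
proof -
  obtain g where g: "arc g" "pathstart g = a" "pathfinish g = b" "path_image g = A"
    using assms(1) by (rule arc_betweenE)
  obtain h where h: "arc h" "pathstart h = b" "pathfinish h = c" "path_image h = B"
    using assms(2) by (rule arc_betweenE)
  have "arc (g +++ h)" using g h assms(3) by (intro arc_join) auto
  then show ?thesis
    using g h unfolding arc_between_def by (intro exI[of _ "g +++ h"]) (simp add: path_image_join)
qed

lemma arc_between_ends:
  assumes "arc_between a b A"
  shows "a \<in> A" "b \<in> A" "a \<noteq> b"
  using assms arc_distinct_ends by (fastforce simp: arc_between_def)+

lemma compact_arc_between:
  fixes A :: "'a::metric_space set"
  assumes "arc_between a b A"
  shows "compact A"
  using assms by (auto simp: arc_between_def intro: compact_arc_image)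

lemma connected_open_arc:
  fixes A :: "'a::metric_space set"
  assumes "arc_between a b A"
  shows "connected (A - {a, b})"
  using assms connected_simple_path_endless[OF arc_imp_simple_path] by (auto simp: arc_between_def)

lemma arc_subset_closure_open_arc:
  fixes A :: "'a::metric_space set"
  assumes "arc_between a b A"
  shows "A \<subseteq> closure (A - {a, b})"
proof -
  obtain g where g: "arc g" "pathstart g = a" "pathfinish g = b" "path_image g = A"
    using assms by (rule arc_betweenE)
  have "continuous_on (closure {0<..<1}) g"
    using arc_imp_path[OF g(1)] by (simp add: path_def)
  then have "g ` closure {0<..<1} \<subseteq> closure (g ` {0<..<1})"
    by (intro image_closure_subset) (auto intro: closure_subset[THEN subsetD])
  then show ?thesis
    using simple_path_endless[OF arc_imp_simple_path[OF g(1)]] g by (simp add: path_image_def)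
qed

lemma open_arc_nonempty:
  fixes A :: "'a::metric_space set"
  assumes "arc_between a b A"
  shows "A - {a, b} \<noteq> {}"
  using arc_subset_closure_open_arc[OF assms] arc_between_ends(1)[OF assms]
  by (metis closure_empty subset_empty empty_iff)

lemma Jordan_arc_pair:
  fixes A B :: "complex set"
  assumes "arc_between a b A" "arc_between a b B" "A \<inter> B = {a, b}"
  shows "inside (A \<union> B) \<noteq> {}" "connected (inside (A \<union> B))" "connected (outside (A \<union> B))"
    "frontier (inside (A \<union> B)) = A \<union> B"
proof -
  obtain g where g: "arc g" "pathstart g = a" "pathfinish g = b" "path_image g = A"
    using assms(1) by (rule arc_betweenE)
  obtain h where h: "arc h" "pathstart h = b" "pathfinish h = a" "path_image h = B"
    using assms(2) arc_between_commute by (metis arc_betweenE)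
  have "simple_path (g +++ h)" using g h assms(3) by (intro simple_path_join_loop) auto
  moreover have "pathfinish (g +++ h) = pathstart (g +++ h)" using g h by simp
  moreover have "path_image (g +++ h) = A \<union> B" using g h by (simp add: path_image_join)
  ultimately show "inside (A \<union> B) \<noteq> {}" "connected (inside (A \<union> B))" "connected (outside (A \<union> B))"
    "frontier (inside (A \<union> B)) = A \<union> B"
    using Jordan_inside_outside[of "g +++ h"] by simp_all
qed

lemma connected_subset_inside:
  fixes K X :: "'a::real_normed_vector set"
  assumes "closed K" "connected X" "X \<inter> K = {}" "X \<inter> inside K \<noteq> {}"
  shows "X \<subseteq> inside K"
proof -
  have cover: "X \<subseteq> inside K \<union> outside K" using assms(3) inside_Un_outside[of K] by blast
  moreover have "inside K \<inter> outside K \<inter> X = {}" using inside_Int_outside[of K] by blast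
  ultimately have "outside K \<inter> X = {}"
    using connectedD[OF assms(2) open_inside[OF assms(1)] open_outside[OF assms(1)]] assms(4)
    by blast
  with cover show ?thesis by blast
qed

lemma inside_eqI:
  fixes K L :: "'a::real_normed_vector set"
  assumes "inside K \<inter> inside L \<noteq> {}" "inside K \<inter> L = {}" "inside L \<inter> K = {}"
    and "closed K" "closed L" "connected (inside K)" "connected (inside L)"
  shows "inside K = inside L"
  using connected_subset_inside[OF assms(4,7,3)] connected_subset_inside[OF assms(5,6,2)] assms(1)
  by blast

definition theta_curve :: "'a::topological_space \<Rightarrow> 'a \<Rightarrow> 'a set \<Rightarrow> 'a set \<Rightarrow> 'a set \<Rightarrow> bool" where
  "theta_curve a b A B C \<longleftrightarrow> arc_between a b A \<and> arc_between a b B \<and> arc_between a b C \<and>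
    A \<inter> B = {a, b} \<and> A \<inter> C = {a, b} \<and> B \<inter> C = {a, b}"

lemma theta_curve_swap: "theta_curve a b A B C \<Longrightarrow> theta_curve a b B A C"
  by (auto simp: theta_curve_def)

lemma theta_curve_inside_disjoint:
  fixes A B C :: "complex set"
  assumes theta: "theta_curve a b A B C"
    and "B \<inter> inside (A \<union> C) = {}" "C \<inter> inside (A \<union> B) = {}"
  shows "inside (A \<union> B) \<inter> inside (A \<union> C) = {}"
proof (rule ccontr)
  assume meet: "inside (A \<union> B) \<inter> inside (A \<union> C) \<noteq> {}"
  have arcs: "arc_between a b A" "arc_between a b B" "arc_between a b C"
    and meets: "A \<inter> B = {a, b}" "A \<inter> C = {a, b}" "B \<inter> C = {a, b}"
    using theta by (auto simp: theta_curve_def)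
  note AB = Jordan_arc_pair[OF arcs(1,2) meets(1)] and AC = Jordan_arc_pair[OF arcs(1,3) meets(2)]
  have "inside (A \<union> B) \<inter> (A \<union> C) = {}" "inside (A \<union> C) \<inter> (A \<union> B) = {}"
    using assms(2,3) inside_no_overlap[of "A \<union> B"] inside_no_overlap[of "A \<union> C"] by blast+
  then have "inside (A \<union> B) = inside (A \<union> C)"
    using meet
    by (intro inside_eqI compact_imp_closed compact_Un AB(2) AC(2) arcs[THEN compact_arc_between])
  then have "A \<union> B = A \<union> C" using AB(4) AC(4) by metis
  then show False using meets open_arc_nonempty[OF arcs(2)] by blast
qed

lemma connected_component_outside:
  fixes K :: "'a::real_normed_vector set"
  assumes "connected (outside K)" "x \<in> outside K" "y \<in> outside K"
  shows "connected_component (- K) x y"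
  using assms outside_no_overlap[of K] unfolding connected_component_def by blast

text \<open>If no arc were inside the other two, a point inside \<open>A \<union> B\<close> would be outside both \<open>A \<union> C\<close> and
  \<open>B \<union> C\<close>, hence by Janiszewski's theorem connected to infinity in the complement of \<open>A \<union> B\<close>.\<close>

lemma theta_curve_some_arc_inside:
  fixes A B C :: "complex set"
  assumes theta: "theta_curve a b A B C"
    and A: "A \<inter> inside (B \<union> C) = {}" and B: "B \<inter> inside (A \<union> C) = {}"
  shows "C \<inter> inside (A \<union> B) \<noteq> {}"
proof
  assume C: "C \<inter> inside (A \<union> B) = {}"
  have arcs: "arc_between a b A" "arc_between a b B" "arc_between a b C"
    and meets: "A \<inter> B = {a, b}" "A \<inter> C = {a, b}" "B \<inter> C = {a, b}"
    using theta by (auto simp: theta_curve_def)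
  note compact = arcs[THEN compact_arc_between]
  obtain x where x: "x \<in> inside (A \<union> B)" using Jordan_arc_pair(1)[OF arcs(1,2) meets(1)] by blast
  have "inside (A \<union> B) \<inter> inside (A \<union> C) = {}" "inside (A \<union> B) \<inter> inside (B \<union> C) = {}"
    using theta_curve_inside_disjoint[OF theta B C]
      theta_curve_inside_disjoint[OF theta_curve_swap[OF theta]] A C by (simp_all add: Un_commute)
  moreover have "x \<notin> A \<union> B \<union> C" using x C inside_no_overlap[of "A \<union> B"] by blast
  ultimately have x': "x \<in> outside (A \<union> C)" "x \<in> outside (B \<union> C)"
    using x inside_Un_outside[of "A \<union> C"] inside_Un_outside[of "B \<union> C"] by blast+
  have "outside (A \<union> B \<union> C) \<noteq> {}"
    by (intro outside_bounded_nonempty compact_imp_bounded compact_Un compact)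
  then obtain y where "y \<in> outside (A \<union> B \<union> C)" by blast
  then have y: "y \<in> outside (A \<union> B)" "y \<in> outside (A \<union> C)" "y \<in> outside (B \<union> C)"
    using outside_mono[of _ "A \<union> B \<union> C"] by blast+
  have "(A \<union> C) \<inter> (B \<union> C) = C" using meets arc_between_ends[OF arcs(3)] by blast
  then have "connected ((A \<union> C) \<inter> (B \<union> C))"
    using arcs(3) by (auto simp: arc_between_def intro: connected_arc_image)
  then have "connected_component (- ((A \<union> C) \<union> (B \<union> C))) x y"
    using x' y Jordan_arc_pair(3)[OF arcs(1,3) meets(2)]
      Jordan_arc_pair(3)[OF arcs(2,3) meets(3)] compact
    by (intro Janiszewski connected_component_outside compact_imp_closed compact_Un)
  then have "connected_component (- (A \<union> B)) x y" by (rule connected_component_of_subset) auto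
  then show False
    using x y(1) by (meson disjoint_iff inside_Int_outside inside_same_component)
qed

lemma arc_ends_in_closed_inside:
  fixes D K :: "'a::real_normed_vector set"
  assumes "arc_between x y D" "closed K"
    and "(D - {x, y}) \<inter> K = {}" "(D - {x, y}) \<inter> inside K \<noteq> {}"
  shows "x \<in> K \<union> inside K" "y \<in> K \<union> inside K"
proof -
  have "D - {x, y} \<subseteq> inside K"
    using assms connected_open_arc by (intro connected_subset_inside)
  then have "D \<subseteq> closure (inside K)"
    using arc_subset_closure_open_arc[OF assms(1)] closure_mono by blast
  then show "x \<in> K \<union> inside K" "y \<in> K \<union> inside K"
    using arc_between_ends[OF assms(1)] closure_inside_subset[OF assms(2)] by blast+
qed

lemma theta_curve_split_inside:
  fixes A B C :: "complex set"
  assumes theta: "theta_curve a b A B C" and C: "C \<inter> inside (A \<union> B) \<noteq> {}"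
  shows "inside (A \<union> C) \<union> inside (B \<union> C) \<union> (C - {a, b}) = inside (A \<union> B)"
proof -
  have arcs: "arc_between a b A" "arc_between a b B" "arc_between a b C"
    and meets: "A \<inter> B = {a, b}" "A \<inter> C = {a, b}" "B \<inter> C = {a, b}"
    using theta by (auto simp: theta_curve_def)
  obtain f g h where "simple_path f" "pathstart f = a" "pathfinish f = b" "path_image f = A"
    "simple_path g" "pathstart g = a" "pathfinish g = b" "path_image g = B"
    "simple_path h" "pathstart h = a" "pathfinish h = b" "path_image h = C"
    using arcs by (metis arc_betweenE arc_imp_simple_path)
  then show ?thesis
    using split_inside_simple_closed_curve[of f a b g h] arc_between_ends(3)[OF arcs(1)] meets C
    by auto
qed

text \<open>Neither the closure of the inside of \<open>A \<union> C\<close> nor that of \<open>B \<union> C\<close> contains both ends of \<open>D\<close>.\<close>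

lemma alternating_chords_meet:
  fixes A B C D :: "complex set"
  assumes theta: "theta_curve a b A B C" and C: "C \<inter> inside (A \<union> B) \<noteq> {}"
    and D: "arc_between x y D" "D - {x, y} \<subseteq> inside (A \<union> B)"
    and x: "x \<in> A - B" and y: "y \<in> B - A"
  shows "C \<inter> D \<noteq> {}"
proof
  assume disj: "C \<inter> D = {}"
  have arcs: "arc_between a b A" "arc_between a b B" "arc_between a b C"
    using theta by (auto simp: theta_curve_def)
  note split = theta_curve_split_inside[OF theta C]
  have xy: "x \<in> D" "y \<in> D" using arc_between_ends[OF D(1)] by auto
  have no_overlap: "(A \<union> B) \<inter> inside (A \<union> B) = {}" by (metis Int_commute inside_no_overlap)
  have closed: "closed (A \<union> C)" "closed (B \<union> C)"
    by (intro compact_imp_closed compact_Un arcs[THEN compact_arc_between])+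
  have away: "(D - {x, y}) \<inter> (A \<union> C) = {}" "(D - {x, y}) \<inter> (B \<union> C) = {}"
    using D(2) disj no_overlap by blast+
  obtain w where "w \<in> D - {x, y}" using open_arc_nonempty[OF D(1)] by blast
  then consider "(D - {x, y}) \<inter> inside (A \<union> C) \<noteq> {}" | "(D - {x, y}) \<inter> inside (B \<union> C) \<noteq> {}"
    using D(2) disj split by blast
  then show False
  proof cases
    case 1
    then have "y \<in> A \<union> C \<union> inside (A \<union> C)"
      by (rule arc_ends_in_closed_inside(2)[OF D(1) closed(1) away(1)])
    then show False using xy y disj split no_overlap by blast
  next
    case 2
    then have "x \<in> B \<union> C \<union> inside (B \<union> C)"
      by (rule arc_ends_in_closed_inside(1)[OF D(1) closed(2) away(2)])
    then show False using xy x disj split no_overlap by blast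
  qed
qed

subsection \<open>Graphs and walks\<close>

definition nbrs :: "'a set set \<Rightarrow> 'a \<Rightarrow> 'a set" where
  "nbrs E v = {w. {v, w} \<in> E}"

lemma nbrs_commute: "w \<in> nbrs E v \<longleftrightarrow> v \<in> nbrs E w"
  by (simp add: nbrs_def insert_commute)

lemma graph_edgeD:
  assumes "finite_simple_graph V E" "{x, y} \<in> E"
  shows "x \<in> V" "y \<in> V" "x \<noteq> y"
proof -
  have "{x, y} \<subseteq> V" "card {x, y} = 2" using assms by (auto simp: finite_simple_graph_def)
  then show "x \<in> V" "y \<in> V" "x \<noteq> y" by (auto simp: card_insert_if split: if_splits)
qed

lemma nbrs_subset: "finite_simple_graph V E \<Longrightarrow> nbrs E v \<subseteq> V - {v}"
  using graph_edgeD[of V E v] by (auto simp: nbrs_def)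

lemma finite_nbrs: "finite_simple_graph V E \<Longrightarrow> finite (nbrs E v)"
  using finite_subset[OF nbrs_subset, of V E v] by (simp add: finite_simple_graph_def)

fun path_edges :: "'a list \<Rightarrow> 'a set set" where
  "path_edges (x # y # zs) = insert {x, y} (path_edges (y # zs))"
| "path_edges _ = {}"

lemma path_edges_subset: "e \<in> path_edges xs \<Longrightarrow> e \<subseteq> set xs"
  by (induction xs rule: path_edges.induct) auto

lemma finite_path_edges: "finite (path_edges xs)"
  by (induction xs rule: path_edges.induct) auto

lemma path_edges_split: "path_edges (xs @ x # ys) = path_edges (xs @ [x]) \<union> path_edges (x # ys)"
  by (induction xs rule: path_edges.induct) auto

lemma path_edges_rev: "path_edges (rev xs) = path_edges xs"
proof (induction xs rule: path_edges.induct)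
  case (1 x y zs)
  then show ?case using path_edges_split[of "rev zs" y "[x]"] by (auto simp: insert_commute)
qed auto

lemma ends_not_path_edge:
  assumes "distinct (a # xs @ [b])" "xs \<noteq> []"
  shows "{a, b} \<notin> path_edges (a # xs @ [b])"
proof -
  obtain x ys where xs: "xs = x # ys" using assms(2) by (cases xs) auto
  have "{a, b} \<notin> path_edges (xs @ [b])"
    using path_edges_subset[of "{a, b}" "xs @ [b]"] assms by auto
  then show ?thesis using assms(1) by (auto simp: xs doubleton_eq_iff)
qed

lemma path_edges_cycle_resplit:
  "path_edges (a # (xs @ x # xs') @ [b]) \<union> path_edges (a # (ys @ y # ys') @ [b]) =
    path_edges (x # (rev xs @ a # ys) @ [y]) \<union> path_edges (x # (xs' @ b # rev ys') @ [y])"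
proof -
  have "path_edges (a # (xs @ x # xs') @ [b]) =
      path_edges (a # xs @ [x]) \<union> path_edges (x # xs' @ [b])"
    for a b x :: 'a and xs xs'
    using path_edges_split[of "a # xs" x "xs' @ [b]"] by simp
  moreover have "path_edges (x # rev xs @ [a]) = path_edges (a # xs @ [x])" for a x :: 'a and xs
    using path_edges_rev[of "a # xs @ [x]"] by simp
  ultimately show ?thesis by blast
qed

definition simple_walk :: "'a set set \<Rightarrow> 'a list \<Rightarrow> bool" where
  "simple_walk E xs \<longleftrightarrow> distinct xs \<and> path_edges xs \<subseteq> E"

lemma simple_walk_rev: "simple_walk E (rev xs) = simple_walk E xs"
  by (simp add: simple_walk_def path_edges_rev)

definition disjoint_paths :: "'a set set \<Rightarrow> 'a \<Rightarrow> 'a \<Rightarrow> 'a list \<Rightarrow> 'a list \<Rightarrow> bool" where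
  "disjoint_paths E a b xs ys \<longleftrightarrow> simple_walk E (a # xs @ [b]) \<and> simple_walk E (a # ys @ [b]) \<and>
    set xs \<inter> set ys = {}"

lemma disjoint_paths_commute: "disjoint_paths E a b xs ys \<longleftrightarrow> disjoint_paths E a b ys xs"
  by (auto simp: disjoint_paths_def)

lemma simple_walk_subset:
  assumes "finite_simple_graph V E" "simple_walk E xs" "length xs \<ge> 2"
  shows "set xs \<subseteq> V"
proof -
  have "path_edges xs \<subseteq> E" using assms(2) by (simp add: simple_walk_def)
  then show ?thesis
    using assms(3)
  proof (induction xs rule: path_edges.induct)
    case (1 x y zs)
    then show ?case using graph_edgeD[OF assms(1), of x y] by (cases zs) auto
  qed auto
qed

subsection \<open>Walks in an outerplanar drawing\<close>

locale outerplane_graph =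
  fixes V :: "'a set" and E :: "'a set set"
    and p :: "'a \<Rightarrow> complex" and c :: "'a set \<Rightarrow> real \<Rightarrow> complex"
  assumes graph: "finite_simple_graph V E"
    and embedding: "plane_embedding V E p c"
    and outer: "p ` V \<subseteq> frontier (outside (drawing V E p c))"
begin

definition walk_image :: "'a list \<Rightarrow> complex set" where
  "walk_image xs = (\<Union>e\<in>path_edges xs. path_image (c e))"

lemma inj_p: "inj_on p V"
  and edge_arc: "e \<in> E \<Longrightarrow> arc (c e)"
  and edge_ends: "e \<in> E \<Longrightarrow> {pathstart (c e), pathfinish (c e)} = p ` e"
  and edge_meets_vertices: "e \<in> E \<Longrightarrow> path_image (c e) \<inter> p ` V = p ` e"
  and edges_meet: "e \<in> E \<Longrightarrow> f \<in> E \<Longrightarrow> e \<noteq> f \<Longrightarrow>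
    path_image (c e) \<inter> path_image (c f) \<subseteq> p ` (e \<inter> f)"
  using embedding by (auto simp: plane_embedding_def)

lemma vertex_not_inside:
  assumes "closed K" "K \<subseteq> drawing V E p c" "v \<in> V"
  shows "p v \<notin> inside K"
proof
  assume v: "p v \<in> inside K"
  have "p v \<in> closure (outside (drawing V E p c))"
    using outer assms(3) by (auto simp: frontier_def)
  then obtain y where "y \<in> inside K" "y \<in> outside (drawing V E p c)"
    using v open_inside[OF assms(1)] by (meson closure_iff_nhds_not_empty order_refl disjoint_iff)
  then show False using outside_mono[OF assms(2)] inside_Int_outside[of K] by blast
qed

lemma edge_arc_between:
  assumes "{x, y} \<in> E"
  shows "arc_between (p x) (p y) (path_image (c {x, y}))"
proof -
  have "{pathstart (c {x, y}), pathfinish (c {x, y})} = {p x, p y}"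
    using edge_ends[OF assms] by simp
  moreover have "arc_between (pathstart (c {x, y})) (pathfinish (c {x, y})) (path_image (c {x, y}))"
    using edge_arc[OF assms] by (auto simp: arc_between_def)
  ultimately show ?thesis by (metis arc_between_commute doubleton_eq_iff)
qed

lemma closed_walk_image:
  assumes "path_edges xs \<subseteq> E"
  shows "closed (walk_image xs)"
  using assms edge_arc unfolding walk_image_def
  by (intro closed_UN finite_path_edges) (auto intro: closed_path_image arc_imp_path)

lemma walk_image_subset_drawing: "path_edges xs \<subseteq> E \<Longrightarrow> walk_image xs \<subseteq> drawing V E p c"
  by (auto simp: walk_image_def drawing_def)

lemma walk_images_meet:
  assumes "path_edges xs \<subseteq> E" "path_edges ys \<subseteq> E" "path_edges xs \<inter> path_edges ys = {}"
  shows "walk_image xs \<inter> walk_image ys \<subseteq> p ` (set xs \<inter> set ys)"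
proof
  fix z assume "z \<in> walk_image xs \<inter> walk_image ys"
  then obtain e f where ef: "e \<in> path_edges xs" "f \<in> path_edges ys"
    "z \<in> path_image (c e)" "z \<in> path_image (c f)" by (auto simp: walk_image_def)
  then have "z \<in> p ` (e \<inter> f)" using edges_meet[of e f] assms by blast
  then show "z \<in> p ` (set xs \<inter> set ys)" using ef path_edges_subset by blast
qed

lemma vertex_in_walk_image:
  "path_edges xs \<subseteq> E \<Longrightarrow> x \<in> set xs \<Longrightarrow> length xs \<ge> 2 \<Longrightarrow> p x \<in> walk_image xs"
proof (induction xs rule: path_edges.induct)
  case (1 a b zs)
  have "p a \<in> path_image (c {a, b})" "p b \<in> path_image (c {a, b})"
    using 1(2) edge_meets_vertices[of "{a, b}"] by auto
  then show ?case using 1 by (cases zs) (auto simp: walk_image_def)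
qed auto

lemma walk_image_arc_between:
  assumes "simple_walk E xs" "length xs \<ge> 2"
  shows "arc_between (p (hd xs)) (p (last xs)) (walk_image xs)"
  using assms
proof (induction xs rule: path_edges.induct)
  case (1 x y zs)
  have xy: "{x, y} \<in> E" using 1(2) by (simp add: simple_walk_def)
  show ?case
  proof (cases zs)
    case Nil
    then show ?thesis using edge_arc_between[OF xy] by (simp add: walk_image_def)
  next
    case (Cons z zs')
    have walk: "simple_walk E (y # zs)" using 1(2) by (simp add: simple_walk_def)
    then have tail: "arc_between (p y) (p (last (y # zs))) (walk_image (y # zs))"
      using 1(1) Cons by simp
    have "path_edges [x, y] \<inter> path_edges (y # zs) = {}"
      using 1(2) path_edges_subset[of _ "y # zs"] by (fastforce simp: simple_walk_def)
    then have "walk_image [x, y] \<inter> walk_image (y # zs) \<subseteq> p ` (set [x, y] \<inter> set (y # zs))"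
      using walk xy by (intro walk_images_meet) (auto simp: simple_walk_def)
    also have "set [x, y] \<inter> set (y # zs) = {y}" using 1(2) by (auto simp: simple_walk_def)
    finally have "path_image (c {x, y}) \<inter> walk_image (y # zs) = {p y}"
      using arc_between_ends(2)[OF edge_arc_between[OF xy]] arc_between_ends(1)[OF tail]
      by (auto simp: walk_image_def)
    from arc_between_join[OF edge_arc_between[OF xy] tail this] show ?thesis
      by (simp add: walk_image_def)
  qed
qed auto

lemma walk_image_path_arc:
  "simple_walk E (a # xs @ [b]) \<Longrightarrow> arc_between (p a) (p b) (walk_image (a # xs @ [b]))"
  using walk_image_arc_between[of "a # xs @ [b]"] by simp

subsection \<open>Excluded subgraphs\<close>

lemma disjoint_paths_meet:
  assumes paths: "disjoint_paths E a b xs ys" and "xs \<noteq> []"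
  shows "walk_image (a # xs @ [b]) \<inter> walk_image (a # ys @ [b]) = {p a, p b}"
proof -
  let ?P = "a # xs @ [b]" and ?Q = "a # ys @ [b]"
  have P: "simple_walk E ?P" and Q: "simple_walk E ?Q" and ab: "set ?P \<inter> set ?Q = {a, b}"
    using paths by (auto simp: disjoint_paths_def simple_walk_def)
  have "e = {a, b}" if "e \<in> path_edges ?P" "e \<in> path_edges ?Q" for e
  proof (rule card_subset_eq)
    show "e \<subseteq> {a, b}" using that path_edges_subset ab by blast
    show "card e = card {a, b}"
      using that P graph by (auto simp: simple_walk_def finite_simple_graph_def)
  qed simp
  then have "path_edges ?P \<inter> path_edges ?Q = {}"
    using ends_not_path_edge[of a xs b] P \<open>xs \<noteq> []\<close> by (auto simp: simple_walk_def)
  then have "walk_image ?P \<inter> walk_image ?Q \<subseteq> p ` (set ?P \<inter> set ?Q)"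
    using P Q by (intro walk_images_meet) (auto simp: simple_walk_def)
  then show ?thesis
    using ab arc_between_ends[OF walk_image_path_arc[OF P]]
      arc_between_ends[OF walk_image_path_arc[OF Q]] by auto
qed

lemma path_not_inside:
  assumes P: "simple_walk E (a # xs @ [b])" "xs \<noteq> []"
    and K: "closed K" "K \<subseteq> drawing V E p c" "walk_image (a # xs @ [b]) \<inter> K = {p a, p b}"
  shows "walk_image (a # xs @ [b]) \<inter> inside K = {}"
proof (rule ccontr)
  let ?P = "a # xs @ [b]"
  assume "walk_image ?P \<inter> inside K \<noteq> {}"
  then have inner: "walk_image ?P - {p a, p b} \<subseteq> inside K"
    using K inside_no_overlap[of K] connected_open_arc[OF walk_image_path_arc[OF P(1)]]
    by (intro connected_subset_inside) blast+
  have PV: "set ?P \<subseteq> V" using simple_walk_subset[OF graph P(1)] by simp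
  obtain x where x: "x \<in> set xs" using P(2) by (meson list.set_sel(1))
  have "p x \<in> walk_image ?P" using P x by (intro vertex_in_walk_image) (auto simp: simple_walk_def)
  moreover have "p x \<noteq> p a" "p x \<noteq> p b"
    using inj_onD[OF inj_p, of x a] inj_onD[OF inj_p, of x b] PV x P by (auto simp: simple_walk_def)
  ultimately show False using inner vertex_not_inside[OF K(1,2), of x] PV x by auto
qed

lemma path_not_inside_two_paths:
  assumes paths: "disjoint_paths E a b xs ys" "disjoint_paths E a b xs zs" and "xs \<noteq> []"
  shows "walk_image (a # xs @ [b]) \<inter>
    inside (walk_image (a # ys @ [b]) \<union> walk_image (a # zs @ [b])) = {}"
proof (rule path_not_inside)
  let ?K = "walk_image (a # ys @ [b]) \<union> walk_image (a # zs @ [b])"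
  show "simple_walk E (a # xs @ [b])" using paths by (simp add: disjoint_paths_def)
  have edges: "path_edges (a # ys @ [b]) \<subseteq> E" "path_edges (a # zs @ [b]) \<subseteq> E"
    using paths by (simp_all add: disjoint_paths_def simple_walk_def)
  show "closed ?K" by (intro closed_Un closed_walk_image edges)
  show "?K \<subseteq> drawing V E p c" by (intro Un_least walk_image_subset_drawing edges)
  show "walk_image (a # xs @ [b]) \<inter> ?K = {p a, p b}"
    using paths[THEN disjoint_paths_meet[OF _ \<open>xs \<noteq> []\<close>]] by blast
qed fact

lemma theta_curve_of_paths:
  assumes "disjoint_paths E a b xs ys" "disjoint_paths E a b xs zs" "disjoint_paths E a b ys zs"
    and "xs \<noteq> []" "ys \<noteq> []"
  shows "theta_curve (p a) (p b) (walk_image (a # xs @ [b])) (walk_image (a # ys @ [b]))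
    (walk_image (a # zs @ [b]))"
  using assms walk_image_path_arc disjoint_paths_meet
  by (simp add: theta_curve_def disjoint_paths_def)

lemma third_path_inside:
  assumes paths: "disjoint_paths E a b xs ys" "disjoint_paths E a b xs zs"
      "disjoint_paths E a b ys zs"
    and nonempty: "xs \<noteq> []" "ys \<noteq> []"
  shows "walk_image (a # zs @ [b]) - {p a, p b} \<subseteq>
    inside (walk_image (a # xs @ [b]) \<union> walk_image (a # ys @ [b]))"
proof -
  let ?P = "walk_image (a # xs @ [b])" and ?Q = "walk_image (a # ys @ [b])"
    and ?R = "walk_image (a # zs @ [b])"
  note theta = theta_curve_of_paths[OF assms]
  have "?P \<inter> inside (?Q \<union> ?R) = {}"
    by (intro path_not_inside_two_paths paths nonempty)
  moreover have "?Q \<inter> inside (?P \<union> ?R) = {}"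
    using paths(1)
    by (intro path_not_inside_two_paths paths nonempty) (simp add: disjoint_paths_commute)
  ultimately have "?R \<inter> inside (?P \<union> ?Q) \<noteq> {}" by (rule theta_curve_some_arc_inside[OF theta])
  moreover have "?R \<inter> (?P \<union> ?Q) = {p a, p b}" using theta by (auto simp: theta_curve_def)
  moreover have "closed (?P \<union> ?Q)"
    using paths(1)
    by (intro closed_Un closed_walk_image) (auto simp: disjoint_paths_def simple_walk_def)
  moreover have "connected (?R - {p a, p b})"
    using theta by (auto simp: theta_curve_def intro: connected_open_arc)
  ultimately show ?thesis
    using inside_no_overlap[of "?P \<union> ?Q"] by (intro connected_subset_inside) blast+
qed

lemma no_theta_subgraph:
  assumes paths: "disjoint_paths E a b xs ys" "disjoint_paths E a b xs zs"
      "disjoint_paths E a b ys zs"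
    and nonempty: "xs \<noteq> []" "ys \<noteq> []" "zs \<noteq> []"
  shows False
proof -
  let ?R = "walk_image (a # zs @ [b])"
  have "?R \<inter> inside (walk_image (a # xs @ [b]) \<union> walk_image (a # ys @ [b])) = {}"
    using paths nonempty by (intro path_not_inside_two_paths) (simp_all add: disjoint_paths_commute)
  moreover have "?R - {p a, p b} \<noteq> {}"
    using paths(2)
    by (intro open_arc_nonempty walk_image_path_arc) (simp add: disjoint_paths_def)
  ultimately show False using third_path_inside[OF paths nonempty(1,2)] by blast
qed

lemma alternating_chord_inside:
  assumes paths: "disjoint_paths E a b xs ys" and x: "x \<in> set xs" and y: "y \<in> set ys"
    and xy: "{x, y} \<in> E"
  shows "walk_image (x # [] @ [y]) - {p x, p y} \<subseteq>
    inside (walk_image (a # xs @ [b]) \<union> walk_image (a # ys @ [b]))"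
proof -
  obtain xs1 xs2 where xs: "xs = xs1 @ x # xs2" using x by (meson split_list)
  obtain ys1 ys2 where ys: "ys = ys1 @ y # ys2" using y by (meson split_list)
  let ?xs = "rev xs1 @ a # ys1" and ?ys = "xs2 @ b # rev ys2"
  have resplit: "path_edges (x # ?xs @ [y]) \<union> path_edges (x # ?ys @ [y]) =
      path_edges (a # xs @ [b]) \<union> path_edges (a # ys @ [b])"
    unfolding xs ys by (rule path_edges_cycle_resplit[symmetric])
  then have edges: "path_edges (x # ?xs @ [y]) \<subseteq> E" "path_edges (x # ?ys @ [y]) \<subseteq> E"
    using paths by (auto simp: disjoint_paths_def simple_walk_def)
  have dist: "distinct (a # xs @ [b])" "distinct (a # ys @ [b])" "set xs \<inter> set ys = {}"
    using paths by (auto simp: disjoint_paths_def simple_walk_def)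
  have "disjoint_paths E x y ?xs ?ys" "disjoint_paths E x y ?xs []" "disjoint_paths E x y ?ys []"
    using dist edges xy unfolding disjoint_paths_def simple_walk_def by (auto simp: xs ys)
  then have "walk_image (x # [] @ [y]) - {p x, p y} \<subseteq>
      inside (walk_image (x # ?xs @ [y]) \<union> walk_image (x # ?ys @ [y]))"
    by (intro third_path_inside) auto
  also have "walk_image (x # ?xs @ [y]) \<union> walk_image (x # ?ys @ [y]) =
      walk_image (a # xs @ [b]) \<union> walk_image (a # ys @ [b])"
    using resplit by (simp add: walk_image_def flip: UN_Un)
  finally show ?thesis .
qed

lemma no_crossing_chords:
  assumes paths: "disjoint_paths E a b xs ys" and x: "x \<in> set xs" and y: "y \<in> set ys"
    and chords: "{a, b} \<in> E" "{x, y} \<in> E"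
  shows False
proof -
  let ?P = "walk_image (a # xs @ [b])" and ?Q = "walk_image (a # ys @ [b])"
    and ?C = "walk_image (a # [] @ [b])" and ?D = "walk_image (x # [] @ [y])"
  have P: "simple_walk E (a # xs @ [b])" and Q: "simple_walk E (a # ys @ [b])"
    using paths by (simp_all add: disjoint_paths_def)
  then have dist: "distinct (a # xs @ [b])" "distinct (a # ys @ [b])" "set xs \<inter> set ys = {}"
    using paths by (auto simp: disjoint_paths_def simple_walk_def)
  have C: "disjoint_paths E a b xs []" "disjoint_paths E a b ys []"
    using P Q chords(1) by (auto simp: disjoint_paths_def simple_walk_def)
  have nonempty: "xs \<noteq> []" "ys \<noteq> []" using x y by auto
  note theta = theta_curve_of_paths[OF paths C nonempty]
  have "?C - {p a, p b} \<subseteq> inside (?P \<union> ?Q)" by (rule third_path_inside[OF paths C nonempty])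
  moreover have "?C - {p a, p b} \<noteq> {}"
    using theta by (auto simp: theta_curve_def dest: open_arc_nonempty)
  ultimately have C_inside: "?C \<inter> inside (?P \<union> ?Q) \<noteq> {}" by blast
  have V: "set (a # xs @ [b]) \<subseteq> V" "set (a # ys @ [b]) \<subseteq> V"
    using simple_walk_subset[OF graph P] simple_walk_subset[OF graph Q] by auto
  have "p x \<in> ?P" "p y \<in> ?Q"
    using P Q x y by (auto intro!: vertex_in_walk_image simp: simple_walk_def)
  moreover have "p x \<notin> {p a, p b}" "p y \<notin> {p a, p b}"
    using V dist x y inj_p by (auto dest: inj_onD)
  ultimately have ends: "p x \<in> ?P - ?Q" "p y \<in> ?Q - ?P" using theta by (auto simp: theta_curve_def)
  have "simple_walk E (x # [] @ [y])" using chords(2) dist x y by (auto simp: simple_walk_def)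
  then have "?C \<inter> ?D \<noteq> {}"
    by (intro alternating_chords_meet[OF theta C_inside _ _ ends] walk_image_path_arc
        alternating_chord_inside[OF paths x y chords(2)])
  moreover have "?C \<inter> ?D \<subseteq> p ` (set (a # [] @ [b]) \<inter> set (x # [] @ [y]))"
    using chords dist x y by (intro walk_images_meet) (auto simp: doubleton_eq_iff)
  moreover have "set (a # [] @ [b]) \<inter> set (x # [] @ [y]) = {}" using dist x y by auto
  ultimately show False by auto
qed

end

subsection \<open>Suppressing a vertex\<close>

definition suppress :: "'a set set \<Rightarrow> 'a \<Rightarrow> 'a set set" where
  "suppress E v = {e \<in> E. v \<notin> e} \<union> {{u, w} | u w. u \<noteq> w \<and> {v, u} \<in> E \<and> {v, w} \<in> E}"

lemma doubleton_in_suppress_iff: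
  "{x, y} \<in> suppress E v \<longleftrightarrow>
    {x, y} \<in> E \<and> x \<noteq> v \<and> y \<noteq> v \<or> x \<noteq> y \<and> x \<in> nbrs E v \<and> y \<in> nbrs E v"
  by (auto simp: suppress_def nbrs_def doubleton_eq_iff)

lemma finite_simple_graph_suppress:
  assumes "finite_simple_graph V E"
  shows "finite_simple_graph (V - {v}) (suppress E v)"
proof -
  have "e \<subseteq> V - {v} \<and> card e = 2" if e: "e \<in> suppress E v" for e
  proof (cases "e \<in> E \<and> v \<notin> e")
    case True
    then show ?thesis using assms by (auto simp: finite_simple_graph_def)
  next
    case False
    then obtain u w where "e = {u, w}" "u \<noteq> w" "{v, u} \<in> E" "{v, w} \<in> E"
      using e by (auto simp: suppress_def)
    then show ?thesis using graph_edgeD[OF assms, of v] by auto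
  qed
  then show ?thesis using assms by (simp add: finite_simple_graph_def)
qed

lemma suppress_degree_2:
  assumes "nbrs E v = {u, w}" "u \<noteq> w"
  shows "suppress E v = insert {u, w} {e \<in> E. v \<notin> e}"
proof -
  have "{{x, y} | x y. x \<noteq> y \<and> {v, x} \<in> E \<and> {v, y} \<in> E} = {{u, w}}"
    using assms unfolding nbrs_def set_eq_iff by (auto simp: doubleton_eq_iff)
  then show ?thesis by (simp add: suppress_def)
qed

lemma card_nbrs_suppress_le:
  assumes graph: "finite_simple_graph V E" and deg: "card (nbrs E v) \<le> 2"
  shows "card (nbrs (suppress E v) x) \<le> card (nbrs E x)"
proof (cases "v \<in> nbrs E x")
  case False
  then have "nbrs (suppress E v) x \<subseteq> nbrs E x"
    using nbrs_commute[of x E v]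
    by (auto simp: nbrs_def[of "suppress E v"] nbrs_def[of E x] doubleton_in_suppress_iff)
  then show ?thesis by (intro card_mono finite_nbrs[OF graph])
next
  case True
  then have x: "x \<in> nbrs E v" using nbrs_commute by metis
  have "nbrs (suppress E v) x \<subseteq> (nbrs E x - {v}) \<union> (nbrs E v - {x})"
    by (auto simp: nbrs_def[of "suppress E v"] nbrs_def[of E x] doubleton_in_suppress_iff)
  then have "card (nbrs (suppress E v) x) \<le> card ((nbrs E x - {v}) \<union> (nbrs E v - {x}))"
    by (intro card_mono) (simp_all add: finite_nbrs[OF graph])
  also have "\<dots> \<le> card (nbrs E x - {v}) + card (nbrs E v - {x})" by (rule card_Un_le)
  also have "\<dots> = card (nbrs E x) - 1 + (card (nbrs E v) - 1)"
    using True x by (simp add: card_Diff_singleton)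
  also have "\<dots> \<le> card (nbrs E x)"
  proof -
    have "card (nbrs E x) > 0" using True finite_nbrs[OF graph] by (metis card_gt_0_iff empty_iff)
    then show ?thesis using deg by linarith
  qed
  finally show ?thesis .
qed

lemma plane_embedding_subgraph:
  assumes emb: "plane_embedding V E p c"
    and sub: "V' \<subseteq> V" "E' \<subseteq> E" "\<And>e. e \<in> E' \<Longrightarrow> e \<subseteq> V'"
  shows "plane_embedding V' E' p c"
proof -
  have "path_image (c e) \<inter> p ` V' = p ` e" if e: "e \<in> E'" for e
  proof -
    have "path_image (c e) \<inter> p ` V' = path_image (c e) \<inter> p ` V \<inter> p ` V'"
      by (simp add: Int_assoc Int_absorb1 image_mono sub(1))
    also have "\<dots> = p ` e \<inter> p ` V'"
      using emb e sub(2) by (simp add: plane_embedding_def subset_iff)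
    also have "\<dots> = p ` e" using sub(3)[OF e] by (simp add: Int_absorb2 image_mono)
    finally show ?thesis .
  qed
  moreover have "inj_on p V'"
    using emb sub(1) by (auto simp: plane_embedding_def intro: inj_on_subset)
  ultimately show ?thesis using emb sub(2) by (simp add: plane_embedding_def subset_iff)
qed

lemma plane_embedding_insert_edge:
  assumes emb: "plane_embedding V E p c" and "f \<notin> E"
    and g: "arc g" "{pathstart g, pathfinish g} = p ` f" "path_image g \<inter> p ` V = p ` f"
    and meets: "\<And>e. e \<in> E \<Longrightarrow> path_image g \<inter> path_image (c e) \<subseteq> p ` (f \<inter> e)"
  shows "plane_embedding V (insert f E) p (c(f := g))"
proof -
  have unchanged: "(c(f := g)) e = c e" if "e \<in> E" for e using that \<open>f \<notin> E\<close> by auto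
  have "path_image ((c(f := g)) e) \<inter> path_image ((c(f := g)) e') \<subseteq> p ` (e \<inter> e')"
    if ee': "e \<in> insert f E" "e' \<in> insert f E" "e \<noteq> e'" for e e'
  proof -
    consider "e = f" "e' \<in> E" | "e \<in> E" "e' = f" | "e \<in> E" "e' \<in> E" using ee' by blast
    then show ?thesis
    proof cases
      case 1
      then show ?thesis using meets unchanged by simp
    next
      case 2
      then show ?thesis using meets[of e] unchanged by (simp add: Int_commute)
    next
      case 3
      then show ?thesis using emb ee'(3) unchanged by (simp add: plane_embedding_def)
    qed
  qed
  then show ?thesis using emb g unchanged unfolding plane_embedding_def by auto
qed

context outerplane_graph
begin

lemma outerplanar_redraw:
  assumes V': "V' \<subseteq> V" and emb: "plane_embedding V' E' p c'"
    and sub: "drawing V' E' p c' \<subseteq> drawing V E p c"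
  shows "outerplanar V' E'"
proof -
  have "p v \<in> frontier (outside (drawing V' E' p c'))" if "v \<in> V'" for v
  proof -
    have "p v \<in> closure (outside (drawing V E p c))"
      using outer V' that by (auto simp: frontier_def)
    then have "p v \<in> closure (outside (drawing V' E' p c'))"
      using closure_mono[OF outside_mono[OF sub]] by blast
    moreover have "p v \<in> drawing V' E' p c'" using that by (simp add: drawing_def)
    then have "p v \<notin> interior (outside (drawing V' E' p c'))"
      using outside_no_overlap interior_subset by fastforce
    ultimately show ?thesis by (simp add: frontier_def)
  qed
  then show ?thesis using emb by (auto simp: outerplanar_def)
qed

lemma plane_embedding_delete: "plane_embedding (V - {v}) {e \<in> E. v \<notin> e} p c"
  using graph by (intro plane_embedding_subgraph[OF embedding]) (auto simp: finite_simple_graph_def)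

lemma outerplanar_suppress_path:
  assumes nbrs_v: "nbrs E v = {u, w}" "u \<noteq> w" and uw: "{u, w} \<notin> E"
  shows "outerplanar (V - {v}) (suppress E v)"
proof -
  have vE: "{v, u} \<in> E" "{v, w} \<in> E" using nbrs_v by (auto simp: nbrs_def)
  note vV = graph_edgeD[OF graph vE(1)] graph_edgeD[OF graph vE(2)]
  note suppress_eq = suppress_degree_2[OF nbrs_v]
  have "simple_walk E (u # [v] @ [w])"
    using vE vV nbrs_v by (auto simp: simple_walk_def insert_commute)
  then have "arc_between (p u) (p w) (path_image (c {v, u}) \<union> path_image (c {v, w}))"
    using walk_image_path_arc[of u "[v]" w] by (simp add: walk_image_def insert_commute)
  then obtain g where g: "arc g" "pathstart g = p u" "pathfinish g = p w"
    "path_image g = path_image (c {v, u}) \<union> path_image (c {v, w})" by (rule arc_betweenE)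
  have "plane_embedding (V - {v}) (suppress E v) p (c({u, w} := g))"
    unfolding suppress_eq
  proof (rule plane_embedding_insert_edge[OF plane_embedding_delete])
    show "{u, w} \<notin> {e \<in> E. v \<notin> e}" using uw by blast
    show "arc g" "{pathstart g, pathfinish g} = p ` {u, w}" using g by auto
    have "path_image g \<inter> p ` V = p ` {v, u} \<union> p ` {v, w}"
      using edge_meets_vertices[OF vE(1)] edge_meets_vertices[OF vE(2)] g(4) by blast
    moreover have "p ` (V - {v}) = p ` V - {p v}"
      using inj_on_image_set_diff[OF inj_p, of V "{v}"] vV by auto
    moreover have "p v \<noteq> p u" "p v \<noteq> p w" using inj_p vV by (auto dest: inj_onD)
    ultimately show "path_image g \<inter> p ` (V - {v}) = p ` {u, w}" by auto
    show "path_image g \<inter> path_image (c e) \<subseteq> p ` ({u, w} \<inter> e)" if "e \<in> {e \<in> E. v \<notin> e}" for e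
    proof -
      have "e \<noteq> {v, u}" "e \<noteq> {v, w}" using that by auto
      then have "path_image g \<inter> path_image (c e) \<subseteq> p ` ({v, u} \<inter> e) \<union> p ` ({v, w} \<inter> e)"
        using that edges_meet[OF vE(1), of e] edges_meet[OF vE(2), of e] g(4) by blast
      also have "\<dots> \<subseteq> p ` ({u, w} \<inter> e)" using that by blast
      finally show ?thesis .
    qed
  qed
  moreover have "drawing (V - {v}) (suppress E v) p (c({u, w} := g)) \<subseteq> drawing V E p c"
    using g(4) vE uw unfolding suppress_eq drawing_def by (auto split: if_splits)
  ultimately show ?thesis by (intro outerplanar_redraw) auto
qed

lemma outerplanar_suppress:
  assumes "card (nbrs E v) \<le> 2"
  shows "outerplanar (V - {v}) (suppress E v)"
proof (cases "suppress E v = {e \<in> E. v \<notin> e}")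
  case True
  then show ?thesis
    using plane_embedding_delete by (intro outerplanar_redraw[of _ _ c]) (auto simp: drawing_def)
next
  case False
  then obtain u w where uw: "u \<noteq> w" "{v, u} \<in> E" "{v, w} \<in> E" "{u, w} \<notin> {e \<in> E. v \<notin> e}"
    by (auto simp: suppress_def)
  then have "{u, w} \<subseteq> nbrs E v" by (auto simp: nbrs_def)
  then have "nbrs E v = {u, w}"
    using card_seteq[OF finite_nbrs[OF graph], of "{u, w}" v] uw(1) assms by auto
  moreover have "{u, w} \<notin> E" using uw graph_edgeD(3)[OF graph] by blast
  ultimately show ?thesis using uw(1) by (intro outerplanar_suppress_path)
qed

subsection \<open>A vertex of degree at most two\<close>

definition longest_walk :: "'a list \<Rightarrow> bool" where
  "longest_walk xs \<longleftrightarrow> simple_walk E xs \<and> set xs \<subseteq> V \<and>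
    (\<forall>ys. simple_walk E ys \<longrightarrow> set ys \<subseteq> V \<longrightarrow> length ys \<le> length xs)"

lemma ex_longest_walk: "\<exists>xs. longest_walk xs"
proof -
  let ?walk = "\<lambda>xs. simple_walk E xs \<and> set xs \<subseteq> V"
  have "length xs \<le> card V" if "?walk xs" for xs
    using that graph card_mono[of V "set xs"]
    by (auto simp: simple_walk_def finite_simple_graph_def distinct_card)
  moreover have "?walk []" by (simp add: simple_walk_def)
  ultimately obtain xs where "?walk xs" "\<forall>ys. ?walk ys \<longrightarrow> length ys \<le> length xs"
    using ex_has_greatest_nat[of ?walk "[]" length "Suc (card V)"] by (auto simp: less_Suc_eq_le)
  then show ?thesis by (auto simp: longest_walk_def)
qed

lemma nbrs_hd_longest_walk:
  assumes longest: "longest_walk (a # xs)"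
  shows "nbrs E a \<subseteq> set xs"
proof (rule ccontr)
  assume "\<not> ?thesis"
  then obtain y where y: "{a, y} \<in> E" "y \<notin> set xs" by (auto simp: nbrs_def)
  have "simple_walk E (y # a # xs)" "set (y # a # xs) \<subseteq> V"
    using longest y graph_edgeD[OF graph y(1)]
    by (auto simp: longest_walk_def simple_walk_def insert_commute)
  then have "length (y # a # xs) \<le> length (a # xs)"
    using longest unfolding longest_walk_def by blast
  then show False by simp
qed

definition lollipop :: "'a \<Rightarrow> 'a list \<Rightarrow> 'a \<Rightarrow> 'a list \<Rightarrow> bool" where
  "lollipop a m b rest \<longleftrightarrow> longest_walk (a # m @ b # rest) \<and> m \<noteq> [] \<and> {a, b} \<in> E"

lemma lollipop_reverse:
  assumes "lollipop a (m @ [z]) b rest"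
  shows "lollipop z (rev m @ [a]) b rest"
proof -
  let ?xs = "a # (m @ [z]) @ b # rest" and ?ys = "z # (rev m @ [a]) @ b # rest"
  have ab: "{a, b} \<in> E" and longest: "longest_walk ?xs" using assms by (auto simp: lollipop_def)
  have split: "path_edges (x # ms @ y # b # zs) =
      path_edges (x # ms @ [y]) \<union> {{y, b}} \<union> path_edges (b # zs)" for x y ms zs
    using path_edges_split[of "x # ms" y "b # zs"] by auto
  have "path_edges (z # rev m @ [a]) = path_edges (a # m @ [z])"
    using path_edges_rev[of "a # m @ [z]"] by simp
  then have "insert {z, b} (path_edges ?ys) = insert {a, b} (path_edges ?xs)"
    by (auto simp: split)
  then have "simple_walk E ?ys" "{z, b} \<in> E"
    using ab longest unfolding longest_walk_def simple_walk_def by auto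
  then show ?thesis using longest by (auto simp: lollipop_def longest_walk_def)
qed

lemma ex_lollipop:
  assumes "V \<noteq> {}" and deg: "\<And>v. v \<in> V \<Longrightarrow> card (nbrs E v) \<ge> 3"
  shows "\<exists>a m b rest. lollipop a m b rest"
proof -
  obtain xs where longest: "longest_walk xs" using ex_longest_walk by blast
  obtain v where "v \<in> V" using assms(1) by blast
  then have "simple_walk E [v]" "set [v] \<subseteq> V" by (auto simp: simple_walk_def)
  then have "length [v] \<le> length xs" using longest unfolding longest_walk_def by blast
  then obtain a ys where xs: "xs = a # ys" by (cases xs) auto
  have nbrs: "nbrs E a \<subseteq> set ys" and a: "a \<in> V"
    using nbrs_hd_longest_walk longest by (auto simp: xs longest_walk_def)
  have "\<not> nbrs E a \<subseteq> {hd ys}"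
    using deg[OF a] card_mono[of "{hd ys}" "nbrs E a"] by auto
  then obtain b where b: "{a, b} \<in> E" "b \<noteq> hd ys" "b \<in> set ys" using nbrs by (auto simp: nbrs_def)
  obtain m rest where ys: "ys = m @ b # rest" using split_list[OF b(3)] by blast
  then have "m \<noteq> []" using b(2) by auto
  then have "lollipop a m b rest" using b(1) longest by (simp add: lollipop_def xs ys)
  then show ?thesis by blast
qed

lemma shortest_lollipop_later_nbr:
  assumes lolli: "lollipop a m b rest"
    and shortest: "\<forall>a' m' b' rest'. lollipop a' m' b' rest' \<longrightarrow> length m \<le> length m'"
    and deg: "card (nbrs E a) \<ge> 3"
  shows "\<exists>t\<in>set rest. {a, t} \<in> E"
proof (rule ccontr)
  assume no_later: "\<not> ?thesis"
  have longest: "longest_walk (a # m @ b # rest)" using lolli by (simp add: lollipop_def)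
  have "y = hd m" if y: "y \<in> set m" "{a, y} \<in> E" for y
  proof (rule ccontr)
    assume "y \<noteq> hd m"
    moreover obtain m1 m2 where m: "m = m1 @ y # m2" using split_list[OF y(1)] by blast
    ultimately have "lollipop a m1 y (m2 @ b # rest)"
      using longest y(2) by (cases m1) (auto simp: lollipop_def)
    then show False using shortest m by fastforce
  qed
  then have "nbrs E a \<subseteq> {hd m, b}"
    using nbrs_hd_longest_walk[OF longest] no_later by (auto simp: nbrs_def)
  then have "card (nbrs E a) \<le> card {hd m, b}" by (intro card_mono) auto
  also have "\<dots> \<le> 2" by (simp add: card_insert_if)
  finally show False using deg by simp
qed

lemma no_crossing_edges_along_walk:
  assumes walk: "simple_walk E (a # m @ b # r @ t # r')" and "{a, b} \<in> E" "{a, t} \<in> E"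
    and q: "q \<in> set m" "s \<in> insert t (set r)" "{q, s} \<in> E"
  shows False
proof (rule no_crossing_chords)
  have "path_edges (a # m @ b # r @ t # r') =
      path_edges (a # m @ [b]) \<union> path_edges (b # r @ [t]) \<union> path_edges (t # r')"
    using path_edges_split[of "a # m" b "r @ t # r'"] path_edges_split[of "b # r" t r'] by auto
  moreover have "path_edges (t # rev r @ [b]) = path_edges (b # r @ [t])"
    using path_edges_rev[of "b # r @ [t]"] by simp
  ultimately show "disjoint_paths E a b m (t # rev r)"
    using walk \<open>{a, t} \<in> E\<close> by (auto simp: disjoint_paths_def simple_walk_def)
  show "q \<in> set m" "s \<in> set (t # rev r)" "{a, b} \<in> E" "{q, s} \<in> E" using q assms(2) by auto
qed

text \<open>Reversing the cycle part of a shortest lollipop gives another one.  Its first vertex and the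
  original one are neighbours on the cycle, and their later neighbours yield crossing chords.\<close>

lemma ex_vertex_degree_le_2:
  assumes "V \<noteq> {}"
  shows "\<exists>v\<in>V. card (nbrs E v) \<le> 2"
proof (rule ccontr)
  assume "\<not> ?thesis"
  then have deg: "card (nbrs E v) \<ge> 3" if "v \<in> V" for v using that by force
  let ?cycle = "\<lambda>n. \<exists>a m b rest. lollipop a m b rest \<and> length m = n"
  obtain n where "?cycle n" "\<And>k. k < n \<Longrightarrow> \<not> ?cycle k"
    using ex_lollipop[OF assms deg] exists_least_iff[of ?cycle] by blast
  then obtain a m b rest where lolli: "lollipop a m b rest"
    and shortest: "\<forall>a' m' b' rest'. lollipop a' m' b' rest' \<longrightarrow> length m \<le> length m'"
    by (metis linorder_not_less)
  obtain bs z where m: "m = bs @ [z]" using lolli rev_exhaust by (auto simp: lollipop_def)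
  have lolli': "lollipop z (rev bs @ [a]) b rest" using lolli unfolding m by (rule lollipop_reverse)
  have walk: "simple_walk E (a # m @ b # rest)" "simple_walk E (z # (rev bs @ [a]) @ b # rest)"
    and V: "a \<in> V" "z \<in> V" and chord: "{a, b} \<in> E" "{z, b} \<in> E"
    using lolli lolli' by (auto simp: lollipop_def longest_walk_def)
  have shortest': "\<forall>a' m' b' rest'. lollipop a' m' b' rest' \<longrightarrow> length (rev bs @ [a]) \<le> length m'"
    using shortest by (simp add: m)
  obtain t where t: "t \<in> set rest" "{a, t} \<in> E"
    using shortest_lollipop_later_nbr[OF lolli shortest deg[OF V(1)]] by blast
  obtain y where y: "y \<in> set rest" "{z, y} \<in> E"
    using shortest_lollipop_later_nbr[OF lolli' shortest' deg[OF V(2)]] by blast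
  obtain r r' where r: "rest = r @ t # r'" using split_list[OF t(1)] by blast
  show False
  proof (cases "y \<in> insert t (set r)")
    case True
    show False
      by (rule no_crossing_edges_along_walk[OF walk(1)[unfolded r] chord(1) t(2) _ True y(2)])
        (simp add: m)
  next
    case False
    then obtain s s' where "r' = s @ y # s'" using y(1) r split_list[of y r'] by auto
    then have r': "rest = (r @ t # s) @ y # s'" using r by simp
    show False
      by (rule no_crossing_edges_along_walk[OF walk(2)[unfolded r'] chord(2) y(2) _ _ t(2)]) auto
  qed
qed

end

subsection \<open>Noncrossing circular orders\<close>

definition noncrossing :: "'a set set \<Rightarrow> 'a list \<Rightarrow> bool" where
  "noncrossing E xs \<longleftrightarrow> (\<forall>a b c d. subseq [a, b, c, d] xs \<longrightarrow> {a, c} \<in> E \<longrightarrow> {b, d} \<notin> E)"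

definition noncrossing_order :: "'a set \<Rightarrow> 'a set set \<Rightarrow> 'a list \<Rightarrow> bool" where
  "noncrossing_order V E xs \<longleftrightarrow> distinct xs \<and> set xs = V \<and> noncrossing E xs"

lemma noncrossingD:
  "noncrossing E xs \<Longrightarrow> subseq [a, b, c, d] xs \<Longrightarrow> {a, c} \<in> E \<Longrightarrow> {b, d} \<in> E \<Longrightarrow> False"
  unfolding noncrossing_def by blast

lemma subseq_imp_subset: "subseq xs ys \<Longrightarrow> set xs \<subseteq> set ys"
  by (auto dest: list_emb_set)

lemma noncrossing_subseq: "noncrossing E ys \<Longrightarrow> subseq xs ys \<Longrightarrow> noncrossing E xs"
  unfolding noncrossing_def by (meson subseq_order.order_trans)

lemma noncrossing_rotate:
  assumes "noncrossing E (xs @ ys)"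
  shows "noncrossing E (ys @ xs)"
  unfolding noncrossing_def
proof (intro allI impI notI)
  fix a b c d assume sub: "subseq [a, b, c, d] (ys @ xs)" and edges: "{a, c} \<in> E" "{b, d} \<in> E"
  obtain zs zs' where zs: "[a, b, c, d] = zs @ zs'" "subseq zs ys" "subseq zs' xs"
    using sub by (auto simp: subseq_append_iff)
  then have "subseq (zs' @ zs) (xs @ ys)" by (intro list_emb_append_mono)
  moreover have "zs' @ zs \<in> {[a, b, c, d], [b, c, d, a], [c, d, a, b], [d, a, b, c]}"
    using zs(1) by (auto simp: Cons_eq_append_conv)
  moreover have "{c, a} \<in> E" "{d, b} \<in> E" using edges by (simp_all add: insert_commute)
  ultimately show False using edges by (auto dest: noncrossingD[OF assms])
qed

lemma noncrossing_order_rotate_to: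
  assumes "noncrossing_order V E xs" "v \<in> V"
  obtains ys where "noncrossing_order V E (v # ys)"
proof -
  obtain ys zs where "xs = ys @ v # zs"
    using assms split_list[of v xs] by (auto simp: noncrossing_order_def)
  then have "noncrossing_order V E (v # zs @ ys)"
    using assms(1) noncrossing_rotate[of E ys "v # zs"] by (auto simp: noncrossing_order_def)
  then show thesis by (rule that)
qed

lemma noncrossing_order_split_at:
  assumes "noncrossing_order V E xs" "u \<in> V" "w \<in> V" "u \<noteq> w"
  obtains ls rs where "noncrossing_order V E (u # ls @ w # rs)"
proof -
  obtain ys where ys: "noncrossing_order V E (u # ys)"
    using noncrossing_order_rotate_to[OF assms(1,2)] .
  then have "w \<in> set ys" using assms(3,4) unfolding noncrossing_order_def by (metis set_ConsD)
  then obtain ls rs where "ys = ls @ w # rs" by (meson split_list)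
  then show thesis using ys that by blast
qed

lemma noncrossing_no_edge_across:
  assumes nc: "noncrossing E (u # ls @ w # rs)" and uw: "{u, w} \<in> E"
    and "x \<in> set ls" "y \<in> set rs"
  shows "{x, y} \<notin> E"
proof -
  have "subseq ([u] @ [x] @ [w] @ [y]) ([u] @ ls @ [w] @ rs)"
    using assms(3,4) by (intro list_emb_append_mono) (auto simp: subseq_singleton_left)
  then show ?thesis using noncrossingD[OF nc _ uw, of x y] by auto
qed

lemma noncrossing_Cons_append:
  assumes nc: "noncrossing E (x # ys)" "noncrossing E (x # zs)"
    and sep: "\<And>y z. y \<in> set ys \<Longrightarrow> z \<in> set zs \<Longrightarrow> {y, z} \<notin> E"
  shows "noncrossing E (x # ys @ zs)"
  unfolding noncrossing_def
proof (intro allI impI notI)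
  fix a b c d
  assume sub: "subseq [a, b, c, d] (x # ys @ zs)" and edges: "{a, c} \<in> E" "{b, d} \<in> E"
  obtain ks ls where split: "(if a = x then [b, c, d] else [a, b, c, d]) = ks @ ls"
    "subseq ks ys" "subseq ls zs"
    using sub by (auto simp: subseq_append_iff split: if_splits)
  have "ks = [] \<or> ls = []"
    using split edges sep subseq_imp_subset[OF split(2)] subseq_imp_subset[OF split(3)]
    by (auto simp: Cons_eq_append_conv split: if_splits)
  then have "subseq [a, b, c, d] (x # ys) \<or> subseq [a, b, c, d] (x # zs)"
    using split by (auto split: if_splits)
  then show False using nc edges unfolding noncrossing_def by blast
qed

lemma subseq_pair_neq_last: "distinct zs \<Longrightarrow> subseq [c, d] zs \<Longrightarrow> c \<noteq> last zs"
  by (induction zs) (auto simp: subseq_singleton_left split: if_splits)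

lemma subseq_triple_neq_hd_last:
  "distinct zs \<Longrightarrow> subseq [b, c, d] zs \<Longrightarrow> c \<noteq> hd zs \<and> c \<noteq> last zs"
proof (induction zs)
  case (Cons z zs)
  have "c \<in> set zs" if "subseq [c, d] zs" using that subseq_imp_subset by fastforce
  moreover have "c \<in> set zs" if "subseq [b, c, d] zs" using that subseq_imp_subset by fastforce
  ultimately show ?case
    using Cons subseq_pair_neq_last[of zs c d] by (auto split: if_splits)
qed simp

lemma noncrossing_order_Cons:
  assumes order: "noncrossing_order (V - {v}) (suppress E v) zs" and "v \<in> V"
    and nbrs: "nbrs E v \<subseteq> {hd zs, last zs}"
  shows "noncrossing_order V E (v # zs)"
proof -
  have zs: "distinct zs" "v \<notin> set zs" "set zs = V - {v}" and nc: "noncrossing (suppress E v) zs"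
    using order by (auto simp: noncrossing_order_def)
  have "noncrossing E (v # zs)"
    unfolding noncrossing_def
  proof (intro allI impI notI)
    fix a b c d assume sub: "subseq [a, b, c, d] (v # zs)" and edges: "{a, c} \<in> E" "{b, d} \<in> E"
    show False
    proof (cases "a = v")
      case True
      then have "subseq [b, c, d] zs" "c \<in> nbrs E v" using sub edges by (auto simp: nbrs_def)
      then show False using subseq_triple_neq_hd_last[OF zs(1)] nbrs by blast
    next
      case False
      then have sub': "subseq [a, b, c, d] zs" using sub by simp
      then have "v \<notin> {a, b, c, d}" using subseq_imp_subset[OF sub'] zs(2) by auto
      then have "{a, c} \<in> suppress E v" "{b, d} \<in> suppress E v"
        using edges by (auto simp: suppress_def)
      then show False using nc sub' unfolding noncrossing_def by blast
    qed
  qed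
  then show ?thesis using zs \<open>v \<in> V\<close> by (auto simp: noncrossing_order_def)
qed

lemma noncrossing_order_suppress:
  assumes graph: "finite_simple_graph V E" and order: "noncrossing_order V E (v # ys)"
    and deg: "card (nbrs E v) \<le> 2"
  shows "noncrossing_order (V - {v}) (suppress E v) ys"
proof -
  have nc: "noncrossing E (v # ys)" and dist: "distinct ys"
    using order by (auto simp: noncrossing_order_def)
  have "noncrossing (suppress E v) ys"
    unfolding noncrossing_def
  proof (intro allI impI notI)
    fix a b c d
    assume sub: "subseq [a, b, c, d] ys" and edges: "{a, c} \<in> suppress E v" "{b, d} \<in> suppress E v"
    have sub': "subseq [a, b, c, d] (v # ys)" "subseq [v, a, b, c] (v # ys)"
      "subseq [v, b, c, d] (v # ys)"
      using sub subseq_order.order_trans[of "[a, b, c]" "[a, b, c, d]" ys]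
      by (auto dest: subseq_Cons')
    consider "{a, c} \<in> E" "{b, d} \<in> E" | "c \<in> nbrs E v" "{b, d} \<in> E" | "{a, c} \<in> E" "b \<in> nbrs E v"
      | "{a, b, c} \<subseteq> nbrs E v"
      using edges by (auto simp: doubleton_in_suppress_iff)
    then show False
    proof cases
      case 2
      then show False using noncrossingD[OF nc sub'(3)] by (simp add: nbrs_def)
    next
      case 3
      then show False using noncrossingD[OF nc sub'(2)] by (simp add: nbrs_def insert_commute)
    next
      case 4
      then have "card {a, b, c} \<le> 2" using deg finite_nbrs[OF graph] by (meson card_mono le_trans)
      moreover have "distinct [a, b, c, d]"
        using sub dist by (metis in_set_subseqs subseqs_distinctD)
      ultimately show False by simp
    qed (use noncrossingD[OF nc] sub' in \<open>auto simp: nbrs_def\<close>)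
  qed
  then show ?thesis using order by (auto simp: noncrossing_order_def)
qed

definition reach :: "'a set set \<Rightarrow> 'a set \<Rightarrow> 'a \<Rightarrow> 'a set" where
  "reach E I u = {x \<in> I. (\<lambda>x y. {x, y} \<in> E \<and> y \<in> I)\<^sup>*\<^sup>* u x}"

lemma reach_step: "x \<in> insert u (reach E I u) \<Longrightarrow> {x, y} \<in> E \<Longrightarrow> y \<in> I \<Longrightarrow> y \<in> reach E I u"
  unfolding reach_def by (auto intro: rtranclp.rtrancl_into_rtrancl)

lemma reach_path:
  assumes x: "x \<in> reach E I u" "{x, w} \<in> E" and "u \<notin> I" "w \<notin> I" "u \<noteq> w"
  shows "\<exists>zs. zs \<noteq> [] \<and> simple_walk E (u # zs @ [w]) \<and> set zs \<subseteq> I"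
proof -
  let ?r = "\<lambda>x y. {x, y} \<in> E \<and> y \<in> I"
  obtain zs where zs: "rtrancl_path ?r u zs x" "distinct (u # zs)"
    using x(1) by (auto simp: reach_def rtranclp_eq_rtrancl_path elim: rtrancl_path_distinct)
  have path: "path_edges (a # as) \<subseteq> E \<and> set as \<subseteq> I \<and> last (a # as) = b"
    if "rtrancl_path ?r a as b" for a as b
    using that by (induction rule: rtrancl_path.induct) auto
  have "zs \<noteq> []" using path[OF zs(1)] x(1) \<open>u \<notin> I\<close> by (auto simp: reach_def)
  then obtain ys where ys: "zs = ys @ [x]"
    using path[OF zs(1)] by (metis append_butlast_last_id last_ConsR)
  then have "path_edges (u # zs @ [w]) \<subseteq> E"
    using path[OF zs(1)] path_edges_split[of "u # ys" x "[w]"] x(2) by simp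
  then have "simple_walk E (u # zs @ [w])"
    using zs(2) path[OF zs(1)] assms(4,5) by (auto simp: simple_walk_def)
  then show ?thesis using \<open>zs \<noteq> []\<close> path[OF zs(1)] by blast
qed

text \<open>The part of \<open>ls\<close> that is connected to \<open>u\<close> is a block hanging at \<open>u\<close> and the rest of \<open>ls\<close> is a
  block hanging at \<open>w\<close>, so both can be moved out of the interval between \<open>u\<close> and \<open>w\<close>.\<close>

lemma noncrossing_clear_interval:
  assumes nc: "noncrossing E (u # ls @ w # rs)" and dist: "distinct (u # ls @ w # rs)"
    and uw: "{u, w} \<in> E"
    and no_path: "\<nexists>zs. zs \<noteq> [] \<and> simple_walk E (u # zs @ [w]) \<and> set zs \<subseteq> set ls"
  shows "\<exists>ks. set ks = set ls \<union> set rs \<and> distinct (w # ks @ [u]) \<and> noncrossing E (w # ks @ [u])"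
proof -
  define A where "A = reach E (set ls) u"
  define us where "us = filter (\<lambda>x. x \<in> A) ls"
  define ws where "ws = filter (\<lambda>x. x \<notin> A) ls"
  have blocks: "set us = A" "set ws = set ls - A" "A \<subseteq> set ls"
    by (auto simp: us_def ws_def A_def reach_def)
  note away_rs = noncrossing_no_edge_across[OF nc uw]
  have away_ws: "{x, y} \<notin> E" if "x \<in> insert u A" "y \<in> set ws" for x y
    using that reach_step[of x u E "set ls" y] by (auto simp: blocks A_def)
  have away_w: "{x, w} \<notin> E" if "x \<in> A" for x
    using that reach_path[of x E "set ls" u w] no_path dist by (auto simp: A_def)
  have "subseq (u # w # rs) (u # ls @ w # rs)" by (auto intro: list_emb_append2)
  then have u_rs: "noncrossing E (u # w # rs)" by (rule noncrossing_subseq[OF nc])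
  have "subseq (u # us) (u # ls @ w # rs)"
    by (auto simp: us_def intro: subseq_rev_drop_many)
  then have u_us: "noncrossing E (u # us)" by (rule noncrossing_subseq[OF nc])
  have "subseq (ws @ [w]) (ls @ w # rs)" by (intro list_emb_append_mono) (auto simp: ws_def)
  then have "subseq (ws @ [w]) (u # ls @ w # rs)" by (rule list_emb_Cons)
  then have w_ws: "noncrossing E (w # ws)"
    using noncrossing_subseq[OF nc] noncrossing_rotate[of E ws "[w]"] by simp
  have "{x, y} \<notin> E" if "x \<in> set (w # rs)" "y \<in> set us" for x y
    using that away_rs[of y x] away_w[of y] blocks by (auto simp: insert_commute)
  with u_rs u_us have "noncrossing E (u # (w # rs) @ us)" by (rule noncrossing_Cons_append)
  then have "noncrossing E (w # rs @ us @ [u])"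
    using noncrossing_rotate[of E "[u]" "w # rs @ us"] by simp
  moreover have "{x, y} \<notin> E" if "x \<in> set ws" "y \<in> set (rs @ us @ [u])" for x y
    using that away_rs away_ws[of y x] blocks by (auto simp: insert_commute)
  ultimately have "noncrossing E (w # ws @ rs @ us @ [u])"
    by (rule noncrossing_Cons_append[OF w_ws])
  then show ?thesis using dist blocks
    by (intro exI[of _ "ws @ rs @ us"]) (auto simp: us_def ws_def)
qed

lemma noncrossing_order_insert_leaf:
  assumes graph: "finite_simple_graph V E" and v: "v \<in> V" "nbrs E v \<subseteq> {u}"
    and order: "noncrossing_order (V - {v}) (suppress E v) xs"
  shows "\<exists>ys. noncrossing_order V E ys"
proof (cases "nbrs E v = {}")
  case True
  then show ?thesis using noncrossing_order_Cons[OF order v(1)] by blast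
next
  case False
  then have "u \<in> V - {v}" using v(2) nbrs_subset[OF graph] by blast
  then obtain ys where "noncrossing_order (V - {v}) (suppress E v) (u # ys)"
    using order noncrossing_order_rotate_to by metis
  then have "noncrossing_order V E (v # u # ys)"
    using noncrossing_order_Cons[OF _ v(1), of E "u # ys"] v(2) by auto
  then show ?thesis by blast
qed

lemma noncrossing_order_insert_between:
  assumes "v \<in> V" and nbrs_v: "nbrs E v = {u, w}" "u \<noteq> w"
    and order: "noncrossing_order (V - {v}) (suppress E v) (u # ls @ w # rs)"
    and no_order: "\<nexists>ys. noncrossing_order V E ys"
  shows "\<exists>zs. zs \<noteq> [] \<and> simple_walk E (u # zs @ [w]) \<and> set zs \<subseteq> set ls"
proof -
  let ?S = "suppress E v"
  have nc: "noncrossing ?S (u # ls @ w # rs)" and dist: "distinct (u # ls @ w # rs)"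
    and verts: "set (u # ls @ w # rs) = V - {v}"
    using order by (simp_all add: noncrossing_order_def)
  have "{u, w} \<in> ?S" using nbrs_v by (simp add: doubleton_in_suppress_iff)
  have "\<not> noncrossing ?S (w # ks @ [u])"
    if "set ks = set ls \<union> set rs" "distinct (w # ks @ [u])" for ks
  proof
    assume "noncrossing ?S (w # ks @ [u])"
    then have "noncrossing_order (V - {v}) ?S (w # ks @ [u])"
      using that verts by (auto simp: noncrossing_order_def)
    then have "noncrossing_order V E (v # w # ks @ [u])"
      using noncrossing_order_Cons[OF _ \<open>v \<in> V\<close>, of E "w # ks @ [u]"] nbrs_v(1) by auto
    then show False using no_order by blast
  qed
  then obtain zs where zs: "zs \<noteq> []" "simple_walk ?S (u # zs @ [w])" "set zs \<subseteq> set ls"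
    using noncrossing_clear_interval[OF nc dist \<open>{u, w} \<in> ?S\<close>] by blast
  have "simple_walk E (u # zs @ [w])"
    using zs(1,2) ends_not_path_edge[of u zs w]
    by (auto simp: simple_walk_def suppress_degree_2[OF nbrs_v])
  then show ?thesis using zs by blast
qed

lemma (in outerplane_graph) noncrossing_order_unsuppress:
  assumes v: "v \<in> V" "card (nbrs E v) \<le> 2"
    and order: "noncrossing_order (V - {v}) (suppress E v) xs"
  shows "\<exists>ys. noncrossing_order V E ys"
proof (cases "\<exists>u. nbrs E v \<subseteq> {u}")
  case True
  then show ?thesis using noncrossing_order_insert_leaf[OF graph v(1) _ order] by blast
next
  case False
  then obtain u w where uw: "u \<in> nbrs E v" "w \<in> nbrs E v" "u \<noteq> w" by blast
  then have nbrs_v: "nbrs E v = {u, w}"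
    using card_seteq[OF finite_nbrs[OF graph], of "{u, w}" v] v(2) by auto
  have uwV: "u \<in> V - {v}" "w \<in> V - {v}" using uw nbrs_subset[OF graph] by blast+
  obtain ls rs where order: "noncrossing_order (V - {v}) (suppress E v) (u # ls @ w # rs)"
    using noncrossing_order_split_at[OF order uwV uw(3)] .
  then have order': "noncrossing_order (V - {v}) (suppress E v) (w # rs @ u # ls)"
    using noncrossing_rotate[of _ "u # ls" "w # rs"] by (auto simp: noncrossing_order_def)
  have dist: "distinct (u # ls @ w # rs)" "v \<notin> set ls \<union> set rs"
    using order by (auto simp: noncrossing_order_def)
  show ?thesis
  proof (rule ccontr)
    assume no_order: "\<not> ?thesis"
    obtain zs where zs: "zs \<noteq> []" "simple_walk E (u # zs @ [w])" "set zs \<subseteq> set ls"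
      using noncrossing_order_insert_between[OF v(1) nbrs_v uw(3) order no_order] by blast
    obtain zs' where zs': "zs' \<noteq> []" "simple_walk E (w # zs' @ [u])" "set zs' \<subseteq> set rs"
      using noncrossing_order_insert_between[OF v(1) _ uw(3)[symmetric] order' no_order] nbrs_v
      by blast
    have "simple_walk E (u # rev zs' @ [w])"
      using simple_walk_rev[of E "w # zs' @ [u]"] zs'(2) by simp
    moreover have "simple_walk E (u # [v] @ [w])"
      using uw nbrs_subset[OF graph, of v] by (auto simp: simple_walk_def nbrs_def insert_commute)
    ultimately have "disjoint_paths E u w zs (rev zs')" "disjoint_paths E u w zs [v]"
      "disjoint_paths E u w (rev zs') [v]"
      using zs(2,3) zs'(3) dist by (auto simp: disjoint_paths_def)
    then show False by (rule no_theta_subgraph) (use zs(1) zs'(1) in simp_all)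
  qed
qed

theorem outerplanar_imp_noncrossing_order:
  assumes "finite_simple_graph V E" "outerplanar V E"
  shows "\<exists>xs. noncrossing_order V E xs"
  using assms
proof (induction "card V" arbitrary: V E rule: less_induct)
  case less
  note graph = less.prems(1)
  show ?case
  proof (cases "V = {}")
    case True
    then show ?thesis by (intro exI[of _ "[]"]) (simp add: noncrossing_order_def noncrossing_def)
  next
    case False
    obtain p c where "plane_embedding V E p c" "p ` V \<subseteq> frontier (outside (drawing V E p c))"
      using less.prems(2) by (auto simp: outerplanar_def)
    then interpret outerplane_graph V E p c using graph by unfold_locales
    obtain v where v: "v \<in> V" "card (nbrs E v) \<le> 2" using ex_vertex_degree_le_2[OF False] by blast
    have "card (V - {v}) < card V"
      using graph v(1) by (intro card_Diff1_less) (simp_all add: finite_simple_graph_def)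
    then have "\<exists>xs. noncrossing_order (V - {v}) (suppress E v) xs"
      using less.hyps finite_simple_graph_suppress[OF graph] outerplanar_suppress[OF v(2)] by blast
    then show ?thesis using noncrossing_order_unsuppress[OF v] by blast
  qed
qed

subsection \<open>Pieces of a noncrossing graph\<close>

definition ball2 :: "('a \<Rightarrow> 'a set) \<Rightarrow> 'a \<Rightarrow> 'a set" where
  "ball2 N v = N v \<union> \<Union>(N ` N v) - {v}"

text \<open>Vertex \<open>v\<close> of a piece \<open>G\<close> on the positions \<open>0..n\<close>, whose edges leave it only at \<open>0\<close> and \<open>n\<close>.
  If \<open>v\<close> is adjacent to exactly one end \<open>x\<close>, then at most \<open>D - card (G `` {x})\<close> further vertices are
  reached through \<open>x\<close>, where \<open>D\<close> bounds the degrees; so both bounds give at most \<open>k\<close> vertices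
  whenever \<open>s \<le> k\<close> and \<open>D + t \<le> k\<close>.\<close>

definition light_in_piece :: "nat \<Rightarrow> nat \<Rightarrow> nat \<Rightarrow> (nat \<times> nat) set \<Rightarrow> nat \<Rightarrow> bool" where
  "light_in_piece s t n G v \<longleftrightarrow> card (G `` {v}) \<le> 2 \<and>
    (\<exists>x\<in>{0, n}. G `` {v} \<inter> {0, n} \<subseteq> {x} \<and>
      card (ball2 (\<lambda>a. G `` {a}) v) \<le> (if x \<in> G `` {v} then card (G `` {x}) + t else s))"

definition all_heavy :: "nat \<Rightarrow> nat \<Rightarrow> nat \<Rightarrow> (nat \<times> nat) set \<Rightarrow> bool" where
  "all_heavy s t n G \<longleftrightarrow> (\<forall>v\<in>{0<..<n}. \<not> light_in_piece s t n G v)"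

definition chord :: "nat \<Rightarrow> (nat \<times> nat) set" where
  "chord n = {(0, n), (n, 0)}"

definition glue :: "nat \<Rightarrow> (nat \<times> nat) set \<Rightarrow> (nat \<times> nat) set \<Rightarrow> (nat \<times> nat) set" where
  "glue m G H = G \<union> map_prod ((+) m) ((+) m) ` H"

text \<open>The condition on \<open>m\<close> makes the decomposition of a piece unique, so that the table below
  contains no duplicates.\<close>

inductive heavy_piece :: "nat \<Rightarrow> nat \<Rightarrow> nat \<Rightarrow> (nat \<times> nat) set \<Rightarrow> bool" for s t where
  step: "G \<in> {{}, chord 1} \<Longrightarrow> heavy_piece s t 1 G"
| glue: "heavy_piece s t m G \<Longrightarrow> heavy_piece s t l H \<Longrightarrow> m = 1 \<or> (0, m) \<in> G \<Longrightarrow>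
    K \<in> {glue m G H, glue m G H \<union> chord (m + l)} \<Longrightarrow> all_heavy s t (m + l) K \<Longrightarrow>
    heavy_piece s t (m + l) K"

definition glued_pieces :: "(nat \<times> nat) set list list \<Rightarrow> nat \<Rightarrow> (nat \<times> nat) set list" where
  "glued_pieces T n = [K. m \<leftarrow> [1..<n], G \<leftarrow> T ! m, m = 1 \<or> (0, m) \<in> G, H \<leftarrow> T ! (n - m),
    K \<leftarrow> [glue m G H, glue m G H \<union> chord n]]"

text \<open>A function of its own, so that rewriting evaluates the previous table only once.\<close>

definition extend_table :: "nat \<Rightarrow> nat \<Rightarrow> (nat \<times> nat) set list list \<Rightarrow> (nat \<times> nat) set list list" where
  "extend_table s t T = T @ [filter (all_heavy s t (length T)) (glued_pieces T (length T))]"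

primrec heavy_table :: "nat \<Rightarrow> nat \<Rightarrow> nat \<Rightarrow> (nat \<times> nat) set list list" where
  "heavy_table s t 0 = [[], [{}, chord 1]]"
| "heavy_table s t (Suc k) = extend_table s t (heavy_table s t k)"

lemma length_heavy_table: "length (heavy_table s t k) = k + 2"
  by (induction k) (auto simp: extend_table_def)

lemma in_glued_pieces_iff:
  "K \<in> set (glued_pieces T n) \<longleftrightarrow> (\<exists>m\<in>{1..<n}. \<exists>G\<in>set (T ! m). (m = 1 \<or> (0, m) \<in> G) \<and>
    (\<exists>H\<in>set (T ! (n - m)). K \<in> {glue m G H, glue m G H \<union> chord n}))"
  unfolding glued_pieces_def set_concat set_map UN_iff bex_simps set_upt
  by (intro bex_cong refl) simp

lemma heavy_piece_pos: "heavy_piece s t n G \<Longrightarrow> 0 < n"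
  by (induction rule: heavy_piece.induct) auto

lemma heavy_piece_in_table: "heavy_piece s t n G \<Longrightarrow> n < k + 2 \<Longrightarrow> G \<in> set (heavy_table s t k ! n)"
proof (induction k arbitrary: n G)
  case 0
  from 0(1) show ?case
  proof cases
    case (glue m G' l H)
    then show ?thesis using 0(2) heavy_piece_pos[of s t m G'] heavy_piece_pos[of s t l H] by simp
  qed auto
next
  case (Suc k)
  show ?case
  proof (cases "n < k + 2")
    case True
    then show ?thesis using Suc by (simp add: extend_table_def nth_append length_heavy_table)
  next
    case False
    then have n: "n = k + 2" using Suc(3) by simp
    from Suc(2) have "G \<in> set (glued_pieces (heavy_table s t k) n) \<and> all_heavy s t n G"
    proof cases
      case (glue m G' l H)
      then have ml: "0 < m" "0 < l" using heavy_piece_pos by blast+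
      have "G' \<in> set (heavy_table s t k ! m)" "H \<in> set (heavy_table s t k ! l)"
        using Suc(1)[of m G'] Suc(1)[of l H] glue ml n by simp_all
      moreover have "m \<in> {1..<m + l}" "m + l - m = l" using ml by auto
      ultimately show ?thesis using glue unfolding in_glued_pieces_iff by metis
    qed (use n in simp)
    then show ?thesis using n by (simp add: extend_table_def nth_append length_heavy_table)
  qed
qed

definition short_heavy_pieces :: "nat \<Rightarrow> nat \<Rightarrow> bool" where
  "short_heavy_pieces s t \<longleftrightarrow> (\<forall>n G. heavy_piece s t n G \<longrightarrow> n \<le> 5)"

text \<open>Pieces with at most five steps combine to pieces with at most ten, so it suffices to see that
  the table is empty from six to ten.\<close>

lemma short_heavy_piecesI:
  assumes empty: "drop 6 (heavy_table s t 9) = replicate 5 []"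
  shows "short_heavy_pieces s t"
proof -
  have "n \<le> 5" if "heavy_piece s t n G" for n G
    using that
  proof (induction rule: heavy_piece.induct)
    case (glue m G l H K)
    have K: "heavy_piece s t (m + l) K" using glue heavy_piece.glue by blast
    have False if "m + l > 5"
    proof -
      have "heavy_table s t 9 ! (m + l) = drop 6 (heavy_table s t 9) ! (m + l - 6)"
        using that by (simp add: length_heavy_table)
      also have "\<dots> = []" unfolding empty using glue.IH by (intro nth_replicate) simp
      finally show False using heavy_piece_in_table[OF K, of 9] glue.IH by simp
    qed
    then show ?case by (meson not_le)
  qed simp
  then show ?thesis by (simp add: short_heavy_pieces_def)
qed

lemma short_heavy_pieces_6_1: "short_heavy_pieces 6 1"
proof (rule short_heavy_piecesI)
  show "drop 6 (heavy_table 6 1 9) = replicate 5 []" by code_simp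
qed

lemma short_heavy_pieces_7_0: "short_heavy_pieces 7 0"
proof (rule short_heavy_piecesI)
  show "drop 6 (heavy_table 7 0 9) = replicate 5 []" by code_simp
qed

locale noncrossing_relation =
  fixes R :: "(nat \<times> nat) set" and N :: nat
  assumes sym: "sym R" and irrefl: "irrefl R" and bounded: "R \<subseteq> {..<N} \<times> {..<N}"
    and noncross: "(a, c) \<in> R \<Longrightarrow> (b, d) \<in> R \<Longrightarrow> a < b \<Longrightarrow> b < c \<Longrightarrow> c < d \<Longrightarrow> False"
begin

definition sealed :: "nat \<Rightarrow> nat \<Rightarrow> bool" where
  "sealed i n \<longleftrightarrow> (\<forall>a b. i < a \<longrightarrow> a < i + n \<longrightarrow> (a, b) \<in> R \<longrightarrow> i \<le> b \<and> b \<le> i + n)"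

definition piece :: "nat \<Rightarrow> nat \<Rightarrow> (nat \<times> nat) set" where
  "piece i n = {(a, b). a \<le> n \<and> b \<le> n \<and> (i + a, i + b) \<in> R}"

lemma R_commute: "(a, b) \<in> R \<longleftrightarrow> (b, a) \<in> R"
  using sym by (auto dest: symD)

lemma finite_R_Image: "finite (R `` A)"
proof (rule finite_subset)
  show "R `` A \<subseteq> {..<N}" using bounded by blast
qed simp

lemma sealedD:
  assumes "sealed i n" "i < a" "a < i + n" "(a, b) \<in> R"
  shows "i \<le> b" "b \<le> i + n"
  using assms unfolding sealed_def by blast+

text \<open>Split at the last neighbour of \<open>i\<close> inside the piece.\<close>

lemma sealed_split:
  assumes "sealed i n" "n \<ge> 2"
  obtains m where "0 < m" "m < n" "m = 1 \<or> (i, i + m) \<in> R" "sealed i m" "sealed (i + m) (n - m)"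
proof -
  let ?M = "insert 1 {a. 0 < a \<and> a < n \<and> (i, i + a) \<in> R}"
  define m where "m = Max ?M"
  have fin: "finite ?M" by simp
  have "m \<in> ?M" unfolding m_def by (rule Max_in) simp_all
  then have m: "0 < m" "m < n" "m = 1 \<or> (i, i + m) \<in> R" using \<open>n \<ge> 2\<close> by auto
  have last: "a \<le> i + m" if "i < a" "a < i + n" "(i, a) \<in> R" for a
  proof -
    have "a - i \<le> m" unfolding m_def using that by (intro Max_ge fin) auto
    then show ?thesis by linarith
  qed
  have no_cross: "\<not> (i < b \<and> b < i + m \<and> i + m < a)" if "(a, b) \<in> R" for a b
    using m(3) noncross[of i "i + m" b a] that R_commute[of a b] by auto
  have "sealed i m"
    unfolding sealed_def
  proof (intro allI impI)
    fix a b assume ab: "i < a" "a < i + m" "(a, b) \<in> R"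
    then show "i \<le> b \<and> b \<le> i + m"
      using sealedD(1)[OF assms(1), of a b] m(2) no_cross[of b a] R_commute[of a b] by auto
  qed
  moreover have "sealed (i + m) (n - m)"
    unfolding sealed_def
  proof (intro allI impI)
    fix a b assume ab: "i + m < a" "a < i + m + (n - m)" "(a, b) \<in> R"
    then have "i \<le> b" "b \<le> i + n" using sealedD[OF assms(1), of a b] by auto
    moreover have "b \<noteq> i" using last[of a] ab m(2) R_commute[of a b] by auto
    ultimately show "i + m \<le> b \<and> b \<le> i + m + (n - m)"
      using no_cross[OF ab(3)] ab(1) m(2) by auto
  qed
  ultimately show thesis by (rule that[OF m])
qed

lemma shifted_piece_iff:
  "(a, b) \<in> map_prod ((+) m) ((+) m) ` piece (i + m) l \<longleftrightarrow>
    m \<le> a \<and> m \<le> b \<and> (a, b) \<in> piece i (m + l)"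
proof
  assume "m \<le> a \<and> m \<le> b \<and> (a, b) \<in> piece i (m + l)"
  then show "(a, b) \<in> map_prod ((+) m) ((+) m) ` piece (i + m) l"
    by (intro image_eqI[of _ _ "(a - m, b - m)"]) (auto simp: piece_def)
qed (auto simp: piece_def add.assoc)

lemma piece_1: "piece i 1 \<in> {{}, chord 1}"
proof -
  have "a \<le> 1 \<and> b \<le> 1 \<and> (i + a, i + b) \<in> R \<longleftrightarrow> (a, b) \<in> chord 1 \<and> (i, i + 1) \<in> R" for a b
    using irrefl R_commute[of i "i + 1"]
    by (cases a; cases b) (auto simp: chord_def irrefl_def le_Suc_eq)
  then have "piece i 1 = (if (i, i + 1) \<in> R then chord 1 else {})" by (auto simp: piece_def)
  then show ?thesis by simp
qed

lemma piece_glue: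
  assumes "sealed i m" "sealed (i + m) l" "0 < m" "0 < l"
  shows "piece i (m + l) = glue m (piece i m) (piece (i + m) l) \<union>
    (if (i, i + (m + l)) \<in> R then chord (m + l) else {})"
proof -
  have across: "a = 0 \<and> b = m + l" if "(a, b) \<in> piece i (m + l)" "a < m" "m < b" for a b
  proof -
    have ab: "(i + a, i + b) \<in> R" "b \<le> m + l" using that(1) by (auto simp: piece_def)
    then have ba: "(i + b, i + a) \<in> R" using R_commute by blast
    have "\<not> 0 < a" using sealedD(2)[OF assms(1) _ _ ab(1)] that by auto
    moreover have "\<not> b < m + l" using sealedD(1)[OF assms(2) _ _ ba] that by auto
    ultimately show ?thesis using ab(2) by auto
  qed
  have commute: "(a, b) \<in> piece i (m + l) \<longleftrightarrow> (b, a) \<in> piece i (m + l)" for a b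
    using R_commute[of "i + a" "i + b"] by (auto simp: piece_def)
  have "(a, b) \<in> piece i (m + l) \<longleftrightarrow>
      (a, b) \<in> piece i m \<or> m \<le> a \<and> m \<le> b \<and> (a, b) \<in> piece i (m + l) \<or>
      (i, i + (m + l)) \<in> R \<and> (a, b) \<in> chord (m + l)" for a b
  proof -
    consider "a \<le> m" "b \<le> m" | "m \<le> a" "m \<le> b" | "a < m" "m < b" | "b < m" "m < a" by linarith
    then show ?thesis
    proof cases
      case 3
      then show ?thesis using across[of a b] assms(3) by (auto simp: chord_def piece_def)
    next
      case 4
      then show ?thesis using across[of b a] commute[of a b] R_commute[of i "i + (m + l)"] assms(3)
        by (auto simp: chord_def piece_def)
    qed (use assms(3,4) in \<open>auto simp: chord_def piece_def\<close>)
  qed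
  then show ?thesis unfolding glue_def set_eq_iff Un_iff by (auto simp: shifted_piece_iff)
qed

lemma piece_Image:
  assumes "a \<le> n"
  shows "(+) i ` (piece i n `` {a}) = R `` {i + a} \<inter> {i..i + n}"
proof
  show "R `` {i + a} \<inter> {i..i + n} \<subseteq> (+) i ` (piece i n `` {a})"
  proof
    fix w assume "w \<in> R `` {i + a} \<inter> {i..i + n}"
    then show "w \<in> (+) i ` (piece i n `` {a})"
      using assms by (intro image_eqI[of _ _ "w - i"]) (auto simp: piece_def)
  qed
qed (auto simp: piece_def)

lemma piece_Image_inner:
  assumes "sealed i n" "0 < v" "v < n"
  shows "(+) i ` (piece i n `` {v}) = R `` {i + v}"
  using piece_Image[of v n i] sealedD[OF assms(1), of "i + v"] assms(2,3) by auto

lemma ball2_subset_piece: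
  assumes sealed: "sealed i n" and v: "0 < v" "v < n"
    and ends: "piece i n `` {v} \<inter> {0, n} \<subseteq> {x}"
  shows "ball2 (\<lambda>a. R `` {a}) (i + v) \<subseteq> (+) i ` ball2 (\<lambda>a. piece i n `` {a}) v \<union>
    (if x \<in> piece i n `` {v} then R `` {i + x} - {i..i + n} else {})"
proof
  let ?G = "piece i n"
  note inner = piece_Image_inner[OF sealed v]
  fix w assume "w \<in> ball2 (\<lambda>a. R `` {a}) (i + v)"
  then have "w \<noteq> i + v" and w: "w \<in> R `` {i + v} \<or> (\<exists>u\<in>R `` {i + v}. w \<in> R `` {u})"
    by (auto simp: ball2_def)
  from w show "w \<in> (+) i ` ball2 (\<lambda>a. ?G `` {a}) v \<union>
    (if x \<in> ?G `` {v} then R `` {i + x} - {i..i + n} else {})"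
  proof
    assume "w \<in> R `` {i + v}"
    then have "w \<in> (+) i ` (?G `` {v})" by (simp add: inner)
    then show ?thesis using \<open>w \<noteq> i + v\<close> by (auto simp: ball2_def)
  next
    assume "\<exists>u\<in>R `` {i + v}. w \<in> R `` {u}"
    then obtain y where y: "y \<in> ?G `` {v}" "w \<in> R `` {i + y}" unfolding inner[symmetric] by blast
    then have "y \<le> n" by (auto simp: piece_def)
    show ?thesis
    proof (cases "w \<in> {i..i + n}")
      case True
      then have "w \<in> (+) i ` (?G `` {y})" using piece_Image[OF \<open>y \<le> n\<close>] y(2) by blast
      then show ?thesis using \<open>w \<noteq> i + v\<close> y(1) by (auto simp: ball2_def)
    next
      case False
      then have "y \<in> {0, n}" using sealedD[OF sealed, of "i + y" w] y(2) \<open>y \<le> n\<close> by fastforce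
      then have "y = x" using ends y(1) by blast
      then show ?thesis using False y by auto
    qed
  qed
qed

lemma card_R_Image_split:
  assumes "x \<le> n"
  shows "card (R `` {i + x}) = card (piece i n `` {x}) + card (R `` {i + x} - {i..i + n})"
proof -
  have "card (piece i n `` {x}) = card (R `` {i + x} \<inter> {i..i + n})"
    unfolding piece_Image[OF assms, symmetric] by (simp add: card_image)
  then show ?thesis using card_Int_Diff[OF finite_R_Image] by metis
qed

lemma light_in_piece_sound:
  assumes sealed: "sealed i n" and v: "0 < v" "v < n"
    and light: "light_in_piece s t n (piece i n) v"
    and deg: "\<And>a. card (R `` {a}) \<le> D" and k: "s \<le> k" "D + t \<le> k"
  shows "card (R `` {i + v}) \<le> 2 \<and> card (ball2 (\<lambda>a. R `` {a}) (i + v)) \<le> k"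
proof
  let ?G = "piece i n" and ?B = "ball2 (\<lambda>a. piece i n `` {a}) v"
  obtain x where x: "x \<in> {0, n}" "?G `` {v} \<inter> {0, n} \<subseteq> {x}"
    and few: "card ?B \<le> (if x \<in> ?G `` {v} then card (?G `` {x}) + t else s)"
    using light unfolding light_in_piece_def by (elim conjE bexE) (rule that)
  show "card (R `` {i + v}) \<le> 2"
    using light unfolding piece_Image_inner[OF sealed v, symmetric]
    by (simp add: light_in_piece_def card_image)
  let ?out = "if x \<in> ?G `` {v} then R `` {i + x} - {i..i + n} else {}"
  have "?B \<subseteq> {..n}" by (auto simp: ball2_def piece_def)
  then have finB: "finite ?B" by (rule finite_subset) simp
  have "card (ball2 (\<lambda>a. R `` {a}) (i + v)) \<le> card ((+) i ` ?B \<union> ?out)"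
    using ball2_subset_piece[OF sealed v x(2)] finB finite_R_Image by (intro card_mono) auto
  also have "\<dots> \<le> card ?B + card ?out"
    using card_Un_le[of "(+) i ` ?B" ?out] by (simp add: card_image)
  also have "\<dots> \<le> k"
    using few k card_R_Image_split[of x n i] x(1) deg[of "i + x"] by (auto split: if_splits)
  finally show "card (ball2 (\<lambda>a. R `` {a}) (i + v)) \<le> k" .
qed

lemma sealed_imp_heavy_piece:
  assumes deg: "\<And>a. card (R `` {a}) \<le> D" and k: "s \<le> k" "D + t \<le> k"
    and heavy: "\<And>v. v < N \<Longrightarrow> card (R `` {v}) \<le> 2 \<Longrightarrow> k < card (ball2 (\<lambda>a. R `` {a}) v)"
    and "sealed i n" "0 < n" "i + n < N"
  shows "heavy_piece s t n (piece i n)"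
  using assms(5-7)
proof (induction n arbitrary: i rule: less_induct)
  case (less n)
  have all_heavy: "all_heavy s t n (piece i n)"
    unfolding all_heavy_def
  proof
    fix v assume "v \<in> {0<..<n}"
    then show "\<not> light_in_piece s t n (piece i n) v"
      using light_in_piece_sound[OF less.prems(1) _ _ _ deg k, of v] heavy[of "i + v"] less.prems(3)
      by force
  qed
  show ?case
  proof (cases "n = 1")
    case True
    show ?thesis unfolding True by (rule heavy_piece.step[OF piece_1])
  next
    case False
    then obtain m where m: "0 < m" "m < n" "m = 1 \<or> (i, i + m) \<in> R"
      "sealed i m" "sealed (i + m) (n - m)"
      using sealed_split[OF less.prems(1)] less.prems(2) by auto
    have n: "n = m + (n - m)" using m(2) by simp
    have parts: "heavy_piece s t m (piece i m)" "heavy_piece s t (n - m) (piece (i + m) (n - m))"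
      using less.IH[of m i] less.IH[of "n - m" "i + m"] m less.prems(3) by auto
    have "m = 1 \<or> (0, m) \<in> piece i m" using m(3) by (auto simp: piece_def)
    moreover have "piece i n \<in> {glue m (piece i m) (piece (i + m) (n - m)),
        glue m (piece i m) (piece (i + m) (n - m)) \<union> chord (m + (n - m))}"
      using piece_glue[OF m(4,5,1)] m(2) n by auto
    ultimately show ?thesis using heavy_piece.glue[OF parts] all_heavy n by simp
  qed
qed

lemma ex_light_position:
  assumes short: "short_heavy_pieces s t"
    and deg: "\<And>a. card (R `` {a}) \<le> D" and k: "s \<le> k" "D + t \<le> k" and N: "N \<ge> 7"
  shows "\<exists>v<N. card (R `` {v}) \<le> 2 \<and> card (ball2 (\<lambda>a. R `` {a}) v) \<le> k"
proof (rule ccontr)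
  assume "\<not> ?thesis"
  then have heavy: "k < card (ball2 (\<lambda>a. R `` {a}) v)" if "v < N" "card (R `` {v}) \<le> 2" for v
    using that by force
  have "sealed 0 (N - 1)" using bounded by (auto simp: sealed_def)
  then have "heavy_piece s t (N - 1) (piece 0 (N - 1))"
    using sealed_imp_heavy_piece[OF deg k heavy] N by simp
  then show False using short N by (auto simp: short_heavy_pieces_def)
qed

end

subsection \<open>Second neighbourhoods in a noncrossing graph\<close>

lemma ball2_image:
  assumes inj: "inj_on h A" and v: "v \<in> A" and closed: "\<And>a. a \<in> A \<Longrightarrow> N a \<subseteq> A"
    and image: "\<And>a. a \<in> A \<Longrightarrow> M (h a) = h ` N a"
  shows "ball2 M (h v) = h ` ball2 N v"
proof -
  have subsets: "N v \<subseteq> A" "\<Union>(N ` N v) \<subseteq> A" using closed v by blast+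
  have "\<Union>(M ` h ` N v) = h ` \<Union>(N ` N v)" using image subsets(1) by (auto simp: subset_iff)
  then have "ball2 M (h v) = h ` (N v \<union> \<Union>(N ` N v)) - h ` {v}"
    using image[OF v] by (simp add: ball2_def image_Un)
  also have "\<dots> = h ` ball2 N v"
    unfolding ball2_def using subsets v by (intro inj_on_image_set_diff[OF inj, symmetric]) auto
  finally show ?thesis .
qed

lemma ball2_nbrs_subset:
  assumes "finite_simple_graph V E"
  shows "ball2 (nbrs E) v \<subseteq> V - {v}"
  using nbrs_subset[OF assms] by (fastforce simp: ball2_def)

lemma subseq_map_nth:
  assumes "sorted_wrt (<) js" "set js \<subseteq> {..<length xs}"
  shows "subseq (map ((!) xs) js) xs"
proof -
  have "subseq js [0..<length xs]" using assms by (intro sorted_subset_imp_subseq) auto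
  then have "subseq (map ((!) xs) js) (map ((!) xs) [0..<length xs])" by (rule subseq_map)
  then show ?thesis by (simp add: map_nth)
qed

definition position_rel :: "'a set set \<Rightarrow> 'a list \<Rightarrow> (nat \<times> nat) set" where
  "position_rel E xs = {(a, b). a < length xs \<and> b < length xs \<and> {xs ! a, xs ! b} \<in> E}"

lemma position_rel_Image: "position_rel E xs `` A \<subseteq> {..<length xs}"
  by (auto simp: position_rel_def)

lemma noncrossing_relation_position_rel:
  assumes graph: "finite_simple_graph V E" and nc: "noncrossing E xs"
  shows "noncrossing_relation (position_rel E xs) (length xs)"
proof
  let ?R = "position_rel E xs"
  show "sym ?R" by (auto simp: position_rel_def sym_def insert_commute)
  show "irrefl ?R"
    using graph_edgeD(3)[OF graph] unfolding position_rel_def irrefl_def by blast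
  show "?R \<subseteq> {..<length xs} \<times> {..<length xs}" by (auto simp: position_rel_def)
  show False if "(a, c) \<in> ?R" "(b, d) \<in> ?R" "a < b" "b < c" "c < d" for a b c d
  proof -
    have "subseq (map ((!) xs) [a, b, c, d]) xs"
      using that by (intro subseq_map_nth) (auto simp: position_rel_def)
    then show False using that(1,2) noncrossingD[OF nc] by (auto simp: position_rel_def)
  qed
qed

lemma nbrs_nth:
  assumes graph: "finite_simple_graph V E" and "set xs = V" and "a < length xs"
  shows "nbrs E (xs ! a) = (!) xs ` (position_rel E xs `` {a})"
proof
  show "nbrs E (xs ! a) \<subseteq> (!) xs ` (position_rel E xs `` {a})"
  proof
    fix x assume x: "x \<in> nbrs E (xs ! a)"
    then have "x \<in> set xs" using nbrs_subset[OF graph] assms(2) by blast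
    then obtain b where "b < length xs" "x = xs ! b" by (auto simp: in_set_conv_nth)
    then show "x \<in> (!) xs ` (position_rel E xs `` {a})"
      using x assms(3) by (auto simp: position_rel_def nbrs_def)
  qed
qed (auto simp: position_rel_def nbrs_def)

lemma ex_light_vertex:
  assumes graph: "finite_simple_graph V E" and order: "noncrossing_order V E xs"
    and short: "short_heavy_pieces s t"
    and deg: "\<And>v. card (nbrs E v) \<le> D" and k: "s \<le> k" "D + t \<le> k" and V: "card V \<ge> 7"
  shows "\<exists>v\<in>V. card (nbrs E v) \<le> 2 \<and> card (ball2 (nbrs E) v) \<le> k"
proof -
  let ?N = "\<lambda>a. position_rel E xs `` {a}"
  have xs: "distinct xs" "set xs = V" "noncrossing E xs"
    using order by (auto simp: noncrossing_order_def)
  interpret noncrossing_relation "position_rel E xs" "length xs"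
    using graph xs(3) by (rule noncrossing_relation_position_rel)
  note nbrs = nbrs_nth[OF graph xs(2)]
  have inj: "inj_on ((!) xs) {..<length xs}" using xs(1) by (auto simp: inj_on_nth)
  have card_nth: "card ((!) xs ` A) = card A" if "A \<subseteq> {..<length xs}" for A
    by (rule card_image[OF inj_on_subset[OF inj that]])
  have card_nbrs: "card (nbrs E (xs ! a)) = card (?N a)" if "a < length xs" for a
    unfolding nbrs[OF that] by (rule card_nth[OF position_rel_Image])
  have "card (?N a) \<le> D" for a
  proof (cases "a < length xs")
    case True
    then show ?thesis using card_nbrs deg by metis
  next
    case False
    then have "?N a = {}" by (auto simp: position_rel_def)
    then show ?thesis by simp
  qed
  moreover have "length xs \<ge> 7" using V xs(1,2) by (auto simp: distinct_card[symmetric])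
  ultimately obtain j where j: "j < length xs" "card (?N j) \<le> 2" "card (ball2 ?N j) \<le> k"
    using ex_light_position[OF short _ k] by blast
  have "ball2 (nbrs E) (xs ! j) = (!) xs ` ball2 ?N j"
    using j(1) by (intro ball2_image[OF inj] position_rel_Image nbrs) simp_all
  moreover have "ball2 ?N j \<subseteq> {..<length xs}" by (auto simp: ball2_def position_rel_def)
  ultimately have "card (ball2 (nbrs E) (xs ! j)) \<le> k" using j(3) card_nth by metis
  moreover have "xs ! j \<in> V" using j(1) xs(2) by auto
  ultimately show ?thesis using j card_nbrs by metis
qed

lemma ball2_suppress:
  assumes "x \<noteq> v"
  shows "ball2 (nbrs E) x - {v} \<subseteq> ball2 (nbrs (suppress E v)) x"
proof
  let ?S = "suppress E v"
  have keep: "b \<in> nbrs ?S a" if "b \<in> nbrs E a" "a \<noteq> v" "b \<noteq> v" for a b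
    using that by (auto simp: nbrs_def suppress_def)
  fix y assume "y \<in> ball2 (nbrs E) x - {v}"
  then have y: "y \<noteq> x" "y \<noteq> v" and "y \<in> nbrs E x \<or> (\<exists>u\<in>nbrs E x. y \<in> nbrs E u)"
    by (auto simp: ball2_def)
  then consider "y \<in> nbrs E x" | "v \<in> nbrs E x" "y \<in> nbrs E v"
    | u where "u \<noteq> v" "u \<in> nbrs E x" "y \<in> nbrs E u" by metis
  then show "y \<in> ball2 (nbrs ?S) x"
  proof cases
    case 1
    then show ?thesis using keep[of y x] y assms by (simp add: ball2_def)
  next
    case 2
    then have "x \<in> nbrs E v" using nbrs_commute by metis
    then have "{x, y} \<in> ?S" using 2(2) y by (simp add: doubleton_in_suppress_iff)
    then show ?thesis using y by (simp add: ball2_def nbrs_def)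
  next
    case 3
    then show ?thesis using keep[of u x] keep[of y u] y assms by (auto simp: ball2_def)
  qed
qed

lemma finite_ball2_nbrs:
  assumes "finite_simple_graph V E"
  shows "finite (ball2 (nbrs E) v)"
  using ball2_nbrs_subset[OF assms, of v] assms
  by (meson finite_Diff finite_subset finite_simple_graph_def)

lemma card_ball2_nbrs_less:
  assumes "finite_simple_graph V E" "v \<in> V"
  shows "card (ball2 (nbrs E) v) < card V"
  using ball2_nbrs_subset[OF assms(1), of v] assms
  by (intro psubset_card_mono) (auto simp: finite_simple_graph_def)

lemma card_ball2_suppress_mono:
  assumes "finite S" "v \<notin> S" "w \<in> S"
  shows "card (ball2 (nbrs E) w \<inter> S) \<le> card (ball2 (nbrs (suppress E v)) w \<inter> S)"
proof (rule card_mono)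
  show "ball2 (nbrs E) w \<inter> S \<subseteq> ball2 (nbrs (suppress E v)) w \<inter> S"
    using ball2_suppress[of w v E] assms(2,3) by blast
qed (use assms(1) in simp)

text \<open>A light vertex outside \<open>S\<close> can be suppressed: this does not increase degrees and loses no pair
  of vertices at distance at most two.\<close>

lemma ex_light_vertex_in_subset:
  assumes "finite_simple_graph V E" "noncrossing_order V E xs"
    and short: "short_heavy_pieces s t"
    and "\<And>v. card (nbrs E v) \<le> D" and k: "s \<le> k" "D + t \<le> k" "5 \<le> k"
    and "S \<subseteq> V" "S \<noteq> {}"
  shows "\<exists>v\<in>S. card (ball2 (nbrs E) v \<inter> S) \<le> k"
  using assms(1,2,4,8,9)
proof (induction "card V" arbitrary: V E xs rule: less_induct)
  case less
  note graph = less.prems(1) and order = less.prems(2)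
  have card_inter: "card (ball2 (nbrs E) v \<inter> S) \<le> card (ball2 (nbrs E) v)" for v
    using finite_ball2_nbrs[OF graph] by (intro card_mono) auto
  show ?case
  proof (cases "card V \<ge> 7")
    case False
    obtain v where v: "v \<in> S" "v \<in> V" using less.prems(4,5) by blast
    have "card (ball2 (nbrs E) v \<inter> S) \<le> k"
      using card_inter[of v] card_ball2_nbrs_less[OF graph v(2)] False k(3) by linarith
    then show ?thesis using v(1) by blast
  next
    case True
    obtain v where v: "v \<in> V" "card (nbrs E v) \<le> 2" "card (ball2 (nbrs E) v) \<le> k"
      using ex_light_vertex[OF graph order short less.prems(3) k(1,2) True] by blast
    show ?thesis
    proof (cases "v \<in> S")
      case True
      then show ?thesis using card_inter v(3) le_trans by blast
    next
      case False
      obtain ys where ys: "noncrossing_order V E (v # ys)"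
        using noncrossing_order_rotate_to[OF order v(1)] .
      have fin: "finite V" "finite S"
        using graph less.prems(4) finite_subset by (auto simp: finite_simple_graph_def)
      have deg: "card (nbrs (suppress E v) x) \<le> D" for x
        using card_nbrs_suppress_le[OF graph v(2)] less.prems(3) le_trans by blast
      have "S \<subseteq> V - {v}" using less.prems(4) False by auto
      then obtain w where w: "w \<in> S" "card (ball2 (nbrs (suppress E v)) w \<inter> S) \<le> k"
        using less.hyps[OF card_Diff1_less[OF fin(1) v(1)] finite_simple_graph_suppress[OF graph]
            noncrossing_order_suppress[OF graph ys v(2)] deg _ less.prems(5)] by blast
      then show ?thesis using card_ball2_suppress_mono[OF fin(2) False w(1)] le_trans by blast
    qed
  qed
qed

subsection \<open>Degrees in the square\<close>

lemma vdegree_eq_card_nbrs: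
  assumes "\<And>e. e \<in> E \<Longrightarrow> card e = 2"
  shows "vdegree E v = card (nbrs E v)"
proof -
  have "e \<in> (\<lambda>w. {v, w}) ` nbrs E v" if e: "e \<in> E" "v \<in> e" for e
  proof -
    obtain x y where "e = {x, y}" using assms[OF e(1)] by (auto simp: card_2_iff)
    then have "e = {v, x} \<or> e = {v, y}" using e(2) by auto
    then show ?thesis using e(1) by (auto simp: nbrs_def)
  qed
  then have "{e \<in> E. v \<in> e} = (\<lambda>w. {v, w}) ` nbrs E v" by (auto simp: nbrs_def)
  moreover have "inj_on (\<lambda>w. {v, w}) (nbrs E v)" by (auto simp: inj_on_def doubleton_eq_iff)
  ultimately show ?thesis by (simp add: vdegree_def card_image)
qed

lemma max_degree_eq_Max_card_nbrs:
  assumes "finite_simple_graph V E"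
  shows "max_degree V E = Max (insert 0 ((\<lambda>v. card (nbrs E v)) ` V))"
  using assms vdegree_eq_card_nbrs[of E] by (simp add: max_degree_def finite_simple_graph_def)

lemma card_nbrs_le_max_degree:
  assumes "finite_simple_graph V E"
  shows "card (nbrs E v) \<le> max_degree V E"
proof (cases "v \<in> V")
  case True
  then show ?thesis
    using assms by (simp add: max_degree_eq_Max_card_nbrs[OF assms] finite_simple_graph_def)
next
  case False
  then have "nbrs E v = {}" using graph_edgeD(1)[OF assms] by (auto simp: nbrs_def)
  then show ?thesis by simp
qed

lemma ex_max_degree_vertex:
  assumes "finite_simple_graph V E" "max_degree V E > 0"
  obtains v where "v \<in> V" "card (nbrs E v) = max_degree V E"
proof -
  have "max_degree V E \<in> insert 0 ((\<lambda>v. card (nbrs E v)) ` V)"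
    unfolding max_degree_eq_Max_card_nbrs[OF assms(1)]
    using assms(1) by (intro Max_in) (auto simp: finite_simple_graph_def)
  then show thesis using assms(2) that by auto
qed

lemma gdist_le_iff:
  "gdist V E u v \<le> enat n \<longleftrightarrow> (\<exists>xs. walk_betw V E u xs v \<and> length xs \<le> Suc n)"
proof
  assume "gdist V E u v \<le> enat n"
  then have "gdist V E u v < enat (Suc n)" by (rule le_less_trans) simp
  then show "\<exists>xs. walk_betw V E u xs v \<and> length xs \<le> Suc n"
    unfolding gdist_def by (auto simp: INF_less_iff)
next
  assume "\<exists>xs. walk_betw V E u xs v \<and> length xs \<le> Suc n"
  then obtain xs where xs: "walk_betw V E u xs v" "length xs - 1 \<le> n" by auto
  have "gdist V E u v \<le> enat (length xs - 1)"
    unfolding gdist_def by (rule INF_lower) (use xs in simp)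
  then show "gdist V E u v \<le> enat n" using xs(2) by (meson enat_ord_simps(1) order_trans)
qed

lemma ex_walk_length_le_3_iff:
  assumes graph: "finite_simple_graph V E" and "u \<noteq> v"
  shows "(\<exists>xs. walk_betw V E u xs v \<and> length xs \<le> 3) \<longleftrightarrow> v \<in> ball2 (nbrs E) u"
proof
  assume "\<exists>xs. walk_betw V E u xs v \<and> length xs \<le> 3"
  then obtain xs where xs: "walk_betw V E u xs v" "length xs \<le> 3" by blast
  then consider "xs = [u]" | "xs = [u, v]" | w where "xs = [u, w, v]"
    by (cases xs; cases "tl xs"; cases "tl (tl xs)") (auto simp: walk_betw_def)
  then show "v \<in> ball2 (nbrs E) u"
    using xs(1) \<open>u \<noteq> v\<close> by cases (auto simp: walk_betw_def ball2_def nbrs_def)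
next
  assume "v \<in> ball2 (nbrs E) u"
  then consider "{u, v} \<in> E" | w where "{u, w} \<in> E" "{w, v} \<in> E"
    by (auto simp: ball2_def nbrs_def)
  then show "\<exists>xs. walk_betw V E u xs v \<and> length xs \<le> 3"
  proof cases
    case 1
    then show ?thesis
      using graph_edgeD[OF graph 1] by (intro exI[of _ "[u, v]"]) (simp add: walk_betw_def)
  next
    case 2
    then show ?thesis
      using graph_edgeD[OF graph 2(1)] graph_edgeD[OF graph 2(2)]
      by (intro exI[of _ "[u, w, v]"]) (simp add: walk_betw_def)
  qed
qed

lemma gdist_1_or_2_iff:
  assumes "finite_simple_graph V E" "u \<noteq> v"
  shows "gdist V E u v = 1 \<or> gdist V E u v = 2 \<longleftrightarrow> v \<in> ball2 (nbrs E) u"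
proof -
  have "\<not> (walk_betw V E u xs v \<and> length xs \<le> Suc 0)" for xs
    using \<open>u \<noteq> v\<close> by (cases xs) (auto simp: walk_betw_def)
  then have "\<not> gdist V E u v \<le> enat 0" unfolding gdist_le_iff by blast
  then have "gdist V E u v = 1 \<or> gdist V E u v = 2 \<longleftrightarrow> gdist V E u v \<le> enat 2"
    by (cases "gdist V E u v") (auto simp: one_enat_def numeral_eq_enat)
  also have "\<dots> \<longleftrightarrow> v \<in> ball2 (nbrs E) u"
    using ex_walk_length_le_3_iff[OF assms] by (simp add: gdist_le_iff eval_nat_numeral)
  finally show ?thesis .
qed

lemma doubleton_in_square_edges_iff:
  assumes graph: "finite_simple_graph V E"
  shows "{u, v} \<in> square_edges V E \<longleftrightarrow> v \<in> ball2 (nbrs E) u"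
proof -
  have commute: "y \<in> ball2 (nbrs E) x \<longleftrightarrow> x \<in> ball2 (nbrs E) y" for x y
    using nbrs_commute[of _ E] by (fastforce simp: ball2_def)
  have "{u, v} \<in> square_edges V E \<longleftrightarrow> u \<in> V \<and> v \<in> V \<and> v \<in> ball2 (nbrs E) u"
    using gdist_1_or_2_iff[OF graph] commute ball2_nbrs_subset[OF graph]
    by (fastforce simp: square_edges_def doubleton_eq_iff)
  then show ?thesis using ball2_nbrs_subset[OF graph] commute by blast
qed

lemma vdegree_induced_square:
  assumes graph: "finite_simple_graph V E" and "v \<in> S"
  shows "vdegree (induced_edges (square_edges V E) S) v = card (ball2 (nbrs E) v \<inter> S)"
proof -
  have "vdegree (induced_edges (square_edges V E) S) v =
      card (nbrs (induced_edges (square_edges V E) S) v)"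
    by (intro vdegree_eq_card_nbrs) (auto simp: induced_edges_def square_edges_def)
  also have "nbrs (induced_edges (square_edges V E) S) v = ball2 (nbrs E) v \<inter> S"
    using \<open>v \<in> S\<close> doubleton_in_square_edges_iff[OF graph] by (auto simp: nbrs_def induced_edges_def)
  finally show ?thesis .
qed

lemma finite_induced_min_degrees:
  "finite V \<Longrightarrow> finite {min_degree S (induced_edges H S) | S. S \<subseteq> V \<and> S \<noteq> {}}"
  by (simp add: setcompr_eq_image)

lemma inductiveness_le:
  assumes "finite V" "V \<noteq> {}"
    and "\<And>S. S \<subseteq> V \<Longrightarrow> S \<noteq> {} \<Longrightarrow> \<exists>v\<in>S. vdegree (induced_edges H S) v \<le> k"
  shows "inductiveness V H \<le> k"
proof -
  have "min_degree S (induced_edges H S) \<le> k" if S: "S \<subseteq> V" "S \<noteq> {}" for S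
  proof -
    obtain v where "v \<in> S" "vdegree (induced_edges H S) v \<le> k" using assms(3)[OF S] by blast
    moreover have "finite S" using S(1) assms(1) by (rule finite_subset)
    ultimately show ?thesis unfolding min_degree_def using S(2) by (subst Min_le_iff) auto
  qed
  then show ?thesis
    unfolding inductiveness_def using assms(2)
    by (intro Max.boundedI finite_induced_min_degrees[OF assms(1)]) auto
qed

lemma inductiveness_ge:
  assumes "finite V" "S \<subseteq> V" "S \<noteq> {}" "\<And>v. v \<in> S \<Longrightarrow> k \<le> vdegree (induced_edges H S) v"
  shows "k \<le> inductiveness V H"
proof -
  have "finite S" using assms(2,1) by (rule finite_subset)
  then have "k \<le> min_degree S (induced_edges H S)"
    unfolding min_degree_def using assms(3,4) by simp
  also have "\<dots> \<le> inductiveness V H"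
    unfolding inductiveness_def
    using assms(2,3) by (intro Max_ge finite_induced_min_degrees[OF assms(1)]) blast
  finally show ?thesis .
qed

lemma max_degree_le_inductiveness_square:
  assumes graph: "finite_simple_graph V E"
  shows "max_degree V E \<le> inductiveness V (square_edges V E)"
proof (cases "max_degree V E = 0")
  case False
  then obtain x where x: "x \<in> V" "card (nbrs E x) = max_degree V E"
    using ex_max_degree_vertex[OF graph] by blast
  let ?S = "insert x (nbrs E x)"
  have fin: "finite ?S" using finite_nbrs[OF graph] by simp
  have "x \<notin> nbrs E x" using nbrs_subset[OF graph] by blast
  then have "card ?S = Suc (max_degree V E)" using x(2) finite_nbrs[OF graph] by simp
  moreover have "card (?S - {v}) \<le> vdegree (induced_edges (square_edges V E) ?S) v"
    if v: "v \<in> ?S" for v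
  proof -
    have "?S - {v} \<subseteq> ball2 (nbrs E) v \<inter> ?S"
      using v nbrs_commute[of v E x] by (auto simp: ball2_def)
    then show ?thesis
      unfolding vdegree_induced_square[OF graph v] using fin by (intro card_mono) auto
  qed
  ultimately have "max_degree V E \<le> vdegree (induced_edges (square_edges V E) ?S) v"
    if "v \<in> ?S" for v
    using that fin by (metis card_Diff_singleton diff_Suc_1)
  moreover have "?S \<subseteq> V" using x(1) nbrs_subset[OF graph] by blast
  moreover have "finite V" using graph by (simp add: finite_simple_graph_def)
  ultimately show ?thesis by (intro inductiveness_ge[where S = ?S]) auto
qed simp

lemma inductiveness_square_le:
  assumes graph: "finite_simple_graph V E" and "outerplanar V E" "V \<noteq> {}"
    and short: "short_heavy_pieces s t"
    and deg: "max_degree V E \<le> D" and k: "s \<le> k" "D + t \<le> k" "5 \<le> k"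
  shows "inductiveness V (square_edges V E) \<le> k"
proof (rule inductiveness_le)
  show "finite V" using graph by (simp add: finite_simple_graph_def)
  obtain xs where order: "noncrossing_order V E xs"
    using outerplanar_imp_noncrossing_order[OF assms(1,2)] by blast
  have nbrs: "card (nbrs E v) \<le> D" for v
    using card_nbrs_le_max_degree[OF graph] deg le_trans by blast
  show "\<exists>v\<in>S. vdegree (induced_edges (square_edges V E) S) v \<le> k" if "S \<subseteq> V" "S \<noteq> {}" for S
    using ex_light_vertex_in_subset[OF graph order short nbrs k that]
      vdegree_induced_square[OF graph] by metis
qed fact

theorem theorem3p1:
  fixes V :: "'a set" and E :: "'a set set" and \<Delta> :: nat
  assumes "finite_simple_graph V E"
    and "outerplanar V E"
    and "max_degree V E = \<Delta>"
    and "\<Delta> \<ge> 5"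
  shows "inductiveness V (square_edges V E) \<le> \<Delta> + 1
    \<and> (\<Delta> \<ge> 7 \<longrightarrow> inductiveness V (square_edges V E) = \<Delta>)"
proof -
  have "V \<noteq> {}" using assms(3,4) by (auto simp: max_degree_def)
  note upper = inductiveness_square_le[OF assms(1,2) this]
  have lower: "\<Delta> \<le> inductiveness V (square_edges V E)"
    using max_degree_le_inductiveness_square[OF assms(1)] assms(3) by simp
  consider "\<Delta> = 5" | "\<Delta> = 6" | "\<Delta> \<ge> 7" using assms(4) by linarith
  then show ?thesis
  proof cases
    case 1
    then show ?thesis using upper[OF short_heavy_pieces_6_1, of 5 6] assms(3) by simp
  next
    case 2
    then show ?thesis using upper[OF short_heavy_pieces_7_0, of 7 7] assms(3) by simp
  next
    case 3
    then show ?thesis using upper[OF short_heavy_pieces_7_0, of \<Delta> \<Delta>] lower assms(3) by simp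
  qed
qed

end
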